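(* Let $\Omega_2\subset\{0,1,2\}^{\mathbb N}$ be the set of sequences in which at least two of the symbols $0,1,2$ occur infinitely many times. Let $G$ be an amenable group generated by four involutions $\tilde a,\tilde b,\tilde c,\tilde d$ such that $\tilde b\tilde c\tilde d=1$. Assume that for some $\omega\in\Omega_2$ there exists a surjective homomorphism $\varphi:G\to G_\omega$ such that $\varphi(\tilde a)=a$, $\varphi(\tilde b)=b_\omega$, $\varphi(\tilde c)=c_\omega$ and $\varphi(\tilde d)=d_\omega$. Then, with respect to the generating set $\{\tilde a,\tilde b,\tilde c,\tilde d\}$, $$\mathrm{sp}(G)=[-\tfrac12,0]\cup[\tfrac12,1].$$
   Context: Spectrum of a group. For a group $G$ with a finite symmetric generating set $S=S^{-1}$, the Markov operator on $l^2(G)$ is $(Mf)(g)=\frac1{|S|}\sum_{s\in S}f(s^{-1}g)$, and $\mathrm{sp}(G)$ denotes the spectrum of $M$ (with respect to the specified $S$). An involution is an element of order 2. The groups $G_\omega$. Let $T$ be the binary rooted tree whose vertices are the finite words over $\{0,1\}$ (the root is the empty word), where two words are joined by an edge iff one is obtained from the other by appending one letter at the end. Put $w_0=\varnothing$ (the empty word) and $w_n=1^{n-1}0$ for $n\ge1$. Let $\sigma_n$ be the automorphism of $T$ given by $\sigma_n(w_n0v)=w_n1v$, $\sigma_n(w_n1v)=w_n0v$ for every finite word $v$, and $\sigma_n(u)=u$ for all other vertices $u$. Associate to the symbols the columns in the alphabet $\{\Pi,\mathrm I\}$: $\overline 0=(\Pi,\Pi,\mathrm I)^{T}$, $\overline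 1=(\Pi,\mathrm I,\Pi)^{T}$, $\overline 2=(\mathrm I,\Pi,\Pi)^{T}$. For $\omega=\omega_1\omega_2\cdots\in\{0,1,2\}^{\mathbb N}$ let $\beta_1<\beta_2<\cdots$ (respectively $\gamma_1<\gamma_2<\cdots$, $\delta_1<\delta_2<\cdots$) be the indices $n\geq 1$ for which the first (respectively second, third) entry of $\overline{\omega_n}$ is $\Pi$. Define automorphisms of $T$ by $a=\sigma_0$, $b_\omega=\prod_i\sigma_{\beta_i}$, $c_\omega=\prod_i\sigma_{\gamma_i}$, $d_\omega=\prod_i\sigma_{\delta_i}$ (the factors in each product commute). $G_\omega$ is the group of automorphisms of $T$ generated by $a,b_\omega,c_\omega,d_\omega$. One has $a^2=b_\omega^2=c_\omega^2=d_\omega^2=b_\omega c_\omega d_\omega=1$. *)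

theory Defs
  imports "HOL-Analysis.Analysis" "HOL-Algebra.Algebra" "HOL-Library.Sublist"
begin

section \<open>The Hilbert space $l^2(G)$, the Markov operator and its spectrum\<close>

text \<open>
  A complex function on the group \<open>G\<close> is represented by a function on the ambient type that
  vanishes outside the carrier, so that equality in \<open>l\<^sup>2(G)\<close> is equality of HOL functions.
\<close>

definition l2_space :: "('a, 'm) monoid_scheme \<Rightarrow> ('a \<Rightarrow> complex) set" where
  "l2_space G = {f. (\<forall>x. x \<notin> carrier G \<longrightarrow> f x = 0) \<and>
                    (\<lambda>x. (cmod (f x))\<^sup>2) summable_on carrier G}"

definition l2_norm :: "('a, 'm) monoid_scheme \<Rightarrow> ('a \<Rightarrow> complex) \<Rightarrow> real" where
  "l2_norm G f = sqrt (\<Sum>\<^sub>\<infinity>x\<in>carrier G. (cmod (f x))\<^sup>2)"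

definition l2_bounded_operator ::
    "('a, 'm) monoid_scheme \<Rightarrow> (('a \<Rightarrow> complex) \<Rightarrow> ('a \<Rightarrow> complex)) \<Rightarrow> bool" where
  "l2_bounded_operator G T \<longleftrightarrow>
     (\<forall>f\<in>l2_space G. T f \<in> l2_space G) \<and>
     (\<forall>f\<in>l2_space G. \<forall>g\<in>l2_space G. T (\<lambda>x. f x + g x) = (\<lambda>x. T f x + T g x)) \<and>
     (\<forall>z. \<forall>f\<in>l2_space G. T (\<lambda>x. z * f x) = (\<lambda>x. z * T f x)) \<and>
     (\<exists>C. \<forall>f\<in>l2_space G. l2_norm G (T f) \<le> C * l2_norm G f)"

definition l2_spectrum ::
    "('a, 'm) monoid_scheme \<Rightarrow> (('a \<Rightarrow> complex) \<Rightarrow> ('a \<Rightarrow> complex)) \<Rightarrow> complex set" where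
  "l2_spectrum G T = {z. \<not> (\<exists>R. l2_bounded_operator G R \<and>
     (\<forall>f\<in>l2_space G. R (\<lambda>x. T f x - z * f x) = f \<and>
                     (\<lambda>x. T (R f) x - z * R f x) = f))}"

definition markov_operator ::
    "('a, 'm) monoid_scheme \<Rightarrow> 'a set \<Rightarrow> ('a \<Rightarrow> complex) \<Rightarrow> ('a \<Rightarrow> complex)" where
  "markov_operator G S f =
     (\<lambda>g. if g \<in> carrier G
          then 1 / of_nat (card S) * (\<Sum>s\<in>S. f (inv\<^bsub>G\<^esub> s \<otimes>\<^bsub>G\<^esub> g)) else 0)"

definition sp :: "('a, 'm) monoid_scheme \<Rightarrow> 'a set \<Rightarrow> complex set" where
  "sp G S = l2_spectrum G (markov_operator G S)"


section \<open>Amenability\<close>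

text \<open>
  Amenability is the existence of a left-invariant mean on the bounded real functions on \<open>G\<close>.
  Positivity refers to the values on the carrier only; together with additivity it makes the mean
  independent of the values of a function outside the carrier.
\<close>

definition bounded_funs :: "('a, 'm) monoid_scheme \<Rightarrow> ('a \<Rightarrow> real) set" where
  "bounded_funs G = {f. bounded (f ` carrier G)}"

definition left_invariant_mean :: "('a, 'm) monoid_scheme \<Rightarrow> (('a \<Rightarrow> real) \<Rightarrow> real) \<Rightarrow> bool" where
  "left_invariant_mean G m \<longleftrightarrow>
     (\<forall>f\<in>bounded_funs G. \<forall>g\<in>bounded_funs G. m (\<lambda>x. f x + g x) = m f + m g) \<and>
     (\<forall>c. \<forall>f\<in>bounded_funs G. m (\<lambda>x. c * f x) = c * m f) \<and>
     (\<forall>f\<in>bounded_funs G. (\<forall>x\<in>carrier G. 0 \<le> f x) \<longrightarrow> 0 \<le> m f) \<and>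
     m (\<lambda>x. 1) = 1 \<and>
     (\<forall>f\<in>bounded_funs G. \<forall>h\<in>carrier G. m (\<lambda>x. f (inv\<^bsub>G\<^esub> h \<otimes>\<^bsub>G\<^esub> x)) = m f)"

definition amenable :: "('a, 'm) monoid_scheme \<Rightarrow> bool" where
  "amenable G \<longleftrightarrow> (\<exists>m. left_invariant_mean G m)"


section \<open>The binary rooted tree and its automorphism group\<close>

text \<open>Vertices are the words over \<open>{0, 1}\<close>, with \<open>False\<close> for \<open>0\<close> and \<open>True\<close> for \<open>1\<close>.\<close>

type_synonym vertex = "bool list"

definition tree_edge :: "vertex \<Rightarrow> vertex \<Rightarrow> bool" where
  "tree_edge u v \<longleftrightarrow> (\<exists>x. v = u @ [x] \<or> u = v @ [x])"

definition tree_aut :: "(vertex \<Rightarrow> vertex) set" where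
  "tree_aut = {f. bij f \<and> f [] = [] \<and> (\<forall>u v. tree_edge (f u) (f v) \<longleftrightarrow> tree_edge u v)}"

definition AutT :: "(vertex \<Rightarrow> vertex) monoid" where
  "AutT = \<lparr>carrier = tree_aut, mult = (\<circ>), one = id\<rparr>"


section \<open>The groups $G_\omega$\<close>

fun w_word :: "nat \<Rightarrow> vertex" where
  "w_word 0 = []"
| "w_word (Suc n) = replicate n True @ [False]"

lemma length_w_word [simp]: "length (w_word n) = n"
  by (cases n) auto

text \<open>\<open>\<sigma>\<^sub>n\<close> flips the letter that follows the prefix \<open>w\<^sub>n\<close>.\<close>

definition sigma :: "nat \<Rightarrow> vertex \<Rightarrow> vertex" where
  "sigma n u = (if strict_prefix (w_word n) u then u[n := \<not> u ! n] else u)"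

lemma strict_prefix_iff_append: "strict_prefix p u \<longleftrightarrow> (\<exists>x v. u = p @ x # v)"
proof
  assume "strict_prefix p u"
  then obtain q where "u = p @ q" "q \<noteq> []" by (auto simp: strict_prefix_def prefix_def)
  then show "\<exists>x v. u = p @ x # v" by (cases q) auto
qed (auto simp: strict_prefix_def)

lemma sigma_w: "sigma n (w_word n @ False # v) = w_word n @ True # v"
               "sigma n (w_word n @ True # v) = w_word n @ False # v"
  by (simp_all add: sigma_def strict_prefix_def nth_append list_update_append)

lemma sigma_other: "(\<And>x v. u \<noteq> w_word n @ x # v) \<Longrightarrow> sigma n u = u"
  by (auto simp: sigma_def strict_prefix_iff_append)

text \<open>
  The product of the \<open>\<sigma>\<^sub>n\<close> with \<open>n \<in> A\<close>. Since \<open>\<sigma>\<^sub>n\<close> fixes all words of length at most \<open>n\<close>, only the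
  factors with \<open>n < length u\<close> can act on \<open>u\<close>; by \<open>sigma_prod_stable\<close> below, the value at \<open>u\<close> is the
  eventually constant value of the finite partial products. The order of the factors is
  irrelevant when \<open>0 \<notin> A\<close>.
\<close>

definition sigma_partial_prod :: "nat set \<Rightarrow> nat \<Rightarrow> vertex \<Rightarrow> vertex" where
  "sigma_partial_prod A N = fold sigma (filter (\<lambda>n. n \<in> A) [0..<N])"

definition sigma_prod :: "nat set \<Rightarrow> vertex \<Rightarrow> vertex" where
  "sigma_prod A u = sigma_partial_prod A (length u) u"

lemma length_sigma [simp]: "length (sigma n u) = length u"
  by (simp add: sigma_def)

lemma sigma_short: "length u \<le> n \<Longrightarrow> sigma n u = u"
  by (rule sigma_other) auto

lemma sigma_partial_prod_Suc:
  "sigma_partial_prod A (Suc N) u =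
     (if N \<in> A then sigma N (sigma_partial_prod A N u) else sigma_partial_prod A N u)"
  by (simp add: sigma_partial_prod_def)

lemma length_sigma_partial_prod [simp]: "length (sigma_partial_prod A N u) = length u"
  by (induction N) (simp_all add: sigma_partial_prod_Suc, simp add: sigma_partial_prod_def)

lemma sigma_prod_stable: "length u \<le> N \<Longrightarrow> sigma_partial_prod A N u = sigma_prod A u"
  by (induction N rule: dec_induct)
     (simp_all add: sigma_prod_def sigma_partial_prod_Suc sigma_short)

lemma w_incomparable:
  assumes "0 < m" "m < n" "prefix (w_word m) u" shows "\<not> prefix (w_word n) u"
proof
  assume "prefix (w_word n) u"
  then obtain q where q: "u = w_word n @ q" by (rule prefixE)
  from assms(3) obtain p where p: "u = w_word m @ p" by (rule prefixE)
  from assms obtain i j where ij: "m = Suc i" "n = Suc j" "i < j" by (cases m; cases n) auto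
  have "(w_word m @ p) ! i = (w_word n @ q) ! i" using p q by simp
  moreover have "\<not> (w_word m @ p) ! i" "(w_word n @ q) ! i" using ij by (simp_all add: nth_append)
  ultimately show False by blast
qed

lemma sigma_commute:
  assumes "0 < m" "0 < n" shows "sigma m (sigma n u) = sigma n (sigma m u)"
proof -
  have keep: "prefix (w_word k) (sigma k u)" if "prefix (w_word k) u" for k
  proof (cases "strict_prefix (w_word k) u")
    case True
    then obtain x v where "u = w_word k @ x # v"
      by (auto simp: strict_prefix_iff_append)
    then show ?thesis by (cases x) (simp_all add: sigma_w)
  next
    case False
    with that show ?thesis by (simp add: sigma_def)
  qed
  have fixed: "sigma k v = v" if "\<not> prefix (w_word k) v" for k v
    using that by (auto simp: sigma_def strict_prefix_def)
  have *: "\<not> prefix (w_word k) v" if "0 < k" "0 < l" "k \<noteq> l" "prefix (w_word l) v" for k l v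
    using that w_incomparable[of k l v] w_incomparable[of l k v] by (cases "k < l") auto
  show ?thesis
    using assms * keep fixed by (cases "m = n") metis+
qed

datatype symbol = Sym0 | Sym1 | Sym2

datatype letter = Letter_Pi | Letter_I

fun column :: "symbol \<Rightarrow> letter list" where
  "column Sym0 = [Letter_Pi, Letter_Pi, Letter_I]"
| "column Sym1 = [Letter_Pi, Letter_I, Letter_Pi]"
| "column Sym2 = [Letter_I, Letter_Pi, Letter_Pi]"

text \<open>
  A sequence \<open>\<omega>\<^sub>1 \<omega>\<^sub>2 \<dots>\<close> is a function on \<open>nat\<close> whose value at \<open>0\<close> is never used. The rows of a
  column are counted from \<open>0\<close>, so rows \<open>0\<close>, \<open>1\<close>, \<open>2\<close> give the indices \<open>\<beta>\<^sub>i\<close>, \<open>\<gamma>\<^sub>i\<close>, \<open>\<delta>\<^sub>i\<close>.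
\<close>

definition Pi_indices :: "(nat \<Rightarrow> symbol) \<Rightarrow> nat \<Rightarrow> nat set" where
  "Pi_indices \<omega> r = {n. n \<ge> 1 \<and> column (\<omega> n) ! r = Letter_Pi}"

definition gen_a :: "vertex \<Rightarrow> vertex" where
  "gen_a = sigma 0"

definition gen_b :: "(nat \<Rightarrow> symbol) \<Rightarrow> vertex \<Rightarrow> vertex" where
  "gen_b \<omega> = sigma_prod (Pi_indices \<omega> 0)"

definition gen_c :: "(nat \<Rightarrow> symbol) \<Rightarrow> vertex \<Rightarrow> vertex" where
  "gen_c \<omega> = sigma_prod (Pi_indices \<omega> 1)"

definition gen_d :: "(nat \<Rightarrow> symbol) \<Rightarrow> vertex \<Rightarrow> vertex" where
  "gen_d \<omega> = sigma_prod (Pi_indices \<omega> 2)"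

definition G_omega :: "(nat \<Rightarrow> symbol) \<Rightarrow> (vertex \<Rightarrow> vertex) monoid" where
  "G_omega \<omega> = AutT\<lparr>carrier := generate AutT {gen_a, gen_b \<omega>, gen_c \<omega>, gen_d \<omega>}\<rparr>"

definition Omega2 :: "(nat \<Rightarrow> symbol) set" where
  "Omega2 = {\<omega>. \<exists>i j. i \<noteq> j \<and> infinite {n. n \<ge> 1 \<and> \<omega> n = i} \<and> infinite {n. n \<ge> 1 \<and> \<omega> n = j}}"


section \<open>Well-definedness: the generators are automorphisms of the tree\<close>

lemma sigma_snoc: "\<exists>y. sigma n (u @ [x]) = sigma n u @ [y]"
proof (cases "strict_prefix (w_word n) u")
  case True
  then have "n < length u" and "strict_prefix (w_word n) (u @ [x])"
    using prefix_length_less[OF True] by (auto simp: strict_prefix_def)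
  with True show ?thesis
    by (simp add: sigma_def list_update_append nth_append)
next
  case False
  show ?thesis
  proof (cases "w_word n = u")
    case True
    then have "length u = n" by auto
    with True show ?thesis
      by (auto simp: sigma_def strict_prefix_def list_update_append)
  next
    case neq: False
    with False have "\<not> strict_prefix (w_word n) (u @ [x])"
      by (auto simp: strict_prefix_def)
    with False show ?thesis by (simp add: sigma_def)
  qed
qed

lemma sigma_involutive: "sigma n (sigma n u) = u"
proof (cases "\<exists>x v. u = w_word n @ x # v")
  case True
  then obtain x v where "u = w_word n @ x # v" by blast
  then show ?thesis by (cases x) (simp_all add: sigma_w)
qed (simp add: sigma_other)

lemma sigma_edge: "tree_edge u v \<Longrightarrow> tree_edge (sigma n u) (sigma n v)"
  unfolding tree_edge_def using sigma_snoc by metis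

lemma sigma_tree_aut: "sigma n \<in> tree_aut"
proof -
  have "bij (sigma n)" by (rule o_bij[of "sigma n"]) (auto simp: sigma_involutive)
  moreover have "sigma n [] = []" by (simp add: sigma_short)
  moreover have "tree_edge (sigma n u) (sigma n v) \<longleftrightarrow> tree_edge u v" for u v
    using sigma_edge sigma_involutive by metis
  ultimately show ?thesis by (simp add: tree_aut_def)
qed

lemma comp_tree_aut: "f \<in> tree_aut \<Longrightarrow> g \<in> tree_aut \<Longrightarrow> (\<lambda>u. f (g u)) \<in> tree_aut"
  using bij_comp[of g f] by (auto simp: tree_aut_def comp_def)

lemma sigma_partial_prod_tree_aut: "sigma_partial_prod A N \<in> tree_aut"
proof (induction N)
  case 0
  then show ?case by (simp add: sigma_partial_prod_def tree_aut_def id_def[symmetric])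
next
  case (Suc N)
  then show ?case
    using comp_tree_aut[OF sigma_tree_aut Suc.IH, of N]
    by (cases "N \<in> A") (simp_all add: sigma_partial_prod_Suc[abs_def])
qed

lemma sigma_prod_tree_aut: "sigma_prod A \<in> tree_aut"
proof -
  have P: "bij (sigma_partial_prod A N)"
      "tree_edge (sigma_partial_prod A N u) (sigma_partial_prod A N v) \<longleftrightarrow> tree_edge u v" for N u v
    using sigma_partial_prod_tree_aut[of A N] by (auto simp: tree_aut_def)
  have len: "length (sigma_prod A u) = length u" for u
    by (simp add: sigma_prod_def)
  have "inj (sigma_prod A)"
  proof (rule injI)
    fix u v assume eq: "sigma_prod A u = sigma_prod A v"
    then have "length u = length v" using len by metis
    with eq show "u = v"
      using bij_is_inj[OF P(1)] by (simp add: sigma_prod_def inj_eq)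
  qed
  moreover have "surj (sigma_prod A)"
  proof (rule surjI)
    fix v
    let ?u = "inv_into UNIV (sigma_partial_prod A (length v)) v"
    have u: "sigma_partial_prod A (length v) ?u = v"
      using bij_is_surj[OF P(1)] by (simp add: surj_f_inv_f)
    then have "length ?u = length v" by (metis length_sigma_partial_prod)
    with u show "sigma_prod A ?u = v" by (simp add: sigma_prod_def)
  qed
  moreover have "sigma_prod A [] = []" using len[of "[]"] by simp
  moreover have "tree_edge (sigma_prod A u) (sigma_prod A v) \<longleftrightarrow> tree_edge u v" for u v
    using P(2)[of "max (length u) (length v)" u v] by (simp add: sigma_prod_stable)
  ultimately show ?thesis by (simp add: tree_aut_def bij_def)
qed

lemma gens_in_AutT: "{gen_a, gen_b \<omega>, gen_c \<omega>, gen_d \<omega>} \<subseteq> carrier AutT"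
  by (simp add: AutT_def gen_a_def gen_b_def gen_c_def gen_d_def sigma_tree_aut sigma_prod_tree_aut)

lemma group_AutT: "group AutT"
proof (rule groupI)
  fix f assume f: "f \<in> carrier AutT"
  then have b: "bij f" by (simp add: AutT_def tree_aut_def)
  have "inv_into UNIV f \<in> tree_aut"
    using f b bij_imp_bij_inv[OF b] bij_is_surj[OF b] bij_is_inj[OF b]
    by (simp add: AutT_def tree_aut_def) (metis inv_f_f surj_f_inv_f)
  with b show "\<exists>g\<in>carrier AutT. g \<otimes>\<^bsub>AutT\<^esub> f = \<one>\<^bsub>AutT\<^esub>"
    by (auto simp: AutT_def bij_is_inj intro!: bexI[of _ "inv_into UNIV f"])
qed (auto simp: AutT_def tree_aut_def bij_comp)

lemma group_G_omega: "group (G_omega \<omega>)"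
  unfolding G_omega_def
  by (rule group.subgroup_imp_group[OF group_AutT group.generate_is_subgroup[OF group_AutT gens_in_AutT]])

end

theory Submission
  imports Defs
begin

text \<open>
  Upper bound. The elements \<open>1, b, c, d\<close> form a four-group and \<open>a\<close> is an involution. Let
  \<open>U = (b + c + d - 1) / 2\<close>, acting on \<open>l\<^sup>2(G)\<close>. Twice the projection onto the
  invariant vectors of the four-group is \<open>(1 + b + c + d) / 2 = U + 1\<close>, so \<open>U\<close> is a unitary involution,
  and \<open>M = (a + 2U + 1) / 4\<close>. Now \<open>(a + 2U)\<^sup>2 = 5 + 2(V + V\<inverse>)\<close> with \<open>V = aU\<close> unitary, and
  \<open>V + V\<inverse>\<close> has its spectrum in \<open>[-2, 2]\<close>; hence the spectrum of \<open>a + 2U\<close> lies in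
  \<open>[-3, -1] \<union> [1, 3]\<close>. To get the inverse of \<open>M - z\<close> explicitly, write the relevant constant as
  \<open>q + 1/q\<close> with \<open>|q| < 1\<close> (\<open>joukowski_solution\<close>); then
  \<open>q + 1/q - V - V\<inverse> = (1 - qV)(1 - qV\<inverse>) / q\<close>, and both factors are inverted by Neumann series
  (\<open>neumann_solution\<close>). The result is \<open>two_involutions_spectrum\<close>.

  Lower bound. \<open>G\<close> acts through \<open>\<phi>\<close> on the words of length \<open>n\<close>. Joining each word to its images
  under the generators gives a path with \<open>2\<^sup>n\<close> vertices, along which single edges (from \<open>a\<close>) and double
  edges (from two of \<open>b, c, d\<close>, the third fixing the word) alternate; the shape does not depend on
  \<open>\<omega>\<close>, because every column has exactly two entries \<open>\<Pi>\<close>. On a two-periodic path a plane wave with angle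
  \<open>\<theta>\<close> has \<open>(a + 2U)\<^sup>2 = 5 + 4 cos \<theta>\<close>, so every point \<open>z\<close> of the two intervals has a unimodular solution
  \<open>f\<close> of the eigenvalue equation that fails only at the two ends of the path (\<open>plane_wave\<close>), which is
  negligible against \<open>\<parallel>f\<parallel>\<^sup>2 = 2\<^sup>n\<close>.

  Amenability carries \<open>f\<close> to \<open>l\<^sup>2(G)\<close>. Given a finitely supported density \<open>p\<close> on \<open>G\<close> that is almost
  invariant under the generators, the functions \<open>g \<mapsto> f(gx) \<surd>p(g)\<close>, one for each word \<open>x\<close>, cannot all be
  far from eigenvectors, as the sum over \<open>x\<close> of the squared errors shows
  (\<open>approximate_eigenfunctions_imp_spectrum\<close>). Such densities exist by a minimax argument
  (\<open>amenable_imp_reiter\<close>): otherwise there is a bounded function on \<open>S \<times> G\<close> whose divergence is everywhere at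
  least a positive constant, while an invariant mean annihilates every divergence.
\<close>

section \<open>Square-summable functions and bounded operators\<close>

definition l2_sq :: "('a, 'm) monoid_scheme \<Rightarrow> ('a \<Rightarrow> complex) \<Rightarrow> real" where
  "l2_sq G f = (\<Sum>\<^sub>\<infinity>x\<in>carrier G. (cmod (f x))\<^sup>2)"

lemma l2_sq_nonneg: "0 \<le> l2_sq G f"
  unfolding l2_sq_def by (rule infsum_nonneg) simp

lemma l2_norm_power2: "(l2_norm G f)\<^sup>2 = l2_sq G f"
  using l2_sq_nonneg[of G f] by (simp add: l2_norm_def l2_sq_def)

lemma l2_norm_nonneg: "0 \<le> l2_norm G f"
  using l2_sq_nonneg[of G f] by (simp add: l2_norm_def l2_sq_def)

lemma l2_spaceI:
  assumes "\<And>x. x \<notin> carrier G \<Longrightarrow> f x = 0"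
    and "\<And>F. finite F \<Longrightarrow> F \<subseteq> carrier G \<Longrightarrow> (\<Sum>x\<in>F. (cmod (f x))\<^sup>2) \<le> C"
  shows "f \<in> l2_space G" "l2_sq G f \<le> C"
proof -
  have s: "(\<lambda>x. (cmod (f x))\<^sup>2) summable_on carrier G"
    by (rule nonneg_bdd_above_summable_on) (use assms(2) in \<open>auto simp: bdd_above_def\<close>)
  then show "f \<in> l2_space G" using assms(1) by (auto simp: l2_space_def)
  show "l2_sq G f \<le> C"
    unfolding l2_sq_def by (rule infsum_le_finite_sums[OF s assms(2)])
qed

lemma l2_space_outside: "f \<in> l2_space G \<Longrightarrow> x \<notin> carrier G \<Longrightarrow> f x = 0"
  by (simp add: l2_space_def)

lemma sum_le_l2_sq:
  assumes "f \<in> l2_space G" "finite F" "F \<subseteq> carrier G"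
  shows "(\<Sum>x\<in>F. (cmod (f x))\<^sup>2) \<le> l2_sq G f"
  unfolding l2_sq_def
  by (rule finite_sum_le_infsum) (use assms in \<open>auto simp: l2_space_def\<close>)

lemma norm_le_l2_sq:
  assumes "f \<in> l2_space G" shows "(cmod (f x))\<^sup>2 \<le> l2_sq G f"
proof (cases "x \<in> carrier G")
  case True
  then show ?thesis using sum_le_l2_sq[OF assms, of "{x}"] by simp
qed (simp add: l2_space_outside[OF assms] l2_sq_nonneg)

lemma l2_finite_support:
  assumes "finite B" "B \<subseteq> carrier G" "\<And>x. x \<notin> B \<Longrightarrow> f x = 0"
  shows "f \<in> l2_space G" "l2_sq G f = (\<Sum>x\<in>B. (cmod (f x))\<^sup>2)"
proof -
  have "(\<lambda>x. (cmod (f x))\<^sup>2) summable_on B"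
    using assms(1) by simp
  then have "(\<lambda>x. (cmod (f x))\<^sup>2) summable_on carrier G"
    by (rule summable_on_cong_neutral[THEN iffD1, rotated 3]) (use assms in auto)
  then show "f \<in> l2_space G" using assms by (auto simp: l2_space_def)
  have "l2_sq G f = (\<Sum>\<^sub>\<infinity>x\<in>B. (cmod (f x))\<^sup>2)"
    unfolding l2_sq_def by (rule infsum_cong_neutral) (use assms in auto)
  then show "l2_sq G f = (\<Sum>x\<in>B. (cmod (f x))\<^sup>2)" using assms(1) by simp
qed

lemma l2_scale:
  assumes "f \<in> l2_space G"
  shows "(\<lambda>x. z * f x) \<in> l2_space G" "l2_sq G (\<lambda>x. z * f x) = (cmod z)\<^sup>2 * l2_sq G f"
  using assms
  by (auto simp: l2_space_def l2_sq_def norm_mult power_mult_distrib infsum_cmult_right'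
      intro: summable_on_cmult_right)

lemma cmod_add_power2_le: "(cmod (x + y))\<^sup>2 \<le> 2 * (cmod x)\<^sup>2 + 2 * (cmod y)\<^sup>2"
proof -
  have "(cmod (x + y))\<^sup>2 \<le> (cmod x + cmod y)\<^sup>2"
    by (intro power_mono norm_triangle_ineq norm_ge_zero)
  also have "\<dots> \<le> 2 * (cmod x)\<^sup>2 + 2 * (cmod y)\<^sup>2"
    using zero_le_power2[of "cmod x - cmod y"] by (simp add: power2_eq_square algebra_simps)
  finally show ?thesis .
qed

text \<open>
  The factor 2 instead of the triangle inequality is harmless, because a sum of bounded operators needs
  only some bound.
\<close>

lemma l2_add:
  assumes "f \<in> l2_space G" "g \<in> l2_space G"
  shows "(\<lambda>x. f x + g x) \<in> l2_space G"
    "l2_sq G (\<lambda>x. f x + g x) \<le> 2 * l2_sq G f + 2 * l2_sq G g"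
proof -
  have *: "(\<Sum>x\<in>F. (cmod (f x + g x))\<^sup>2) \<le> 2 * l2_sq G f + 2 * l2_sq G g"
    if F: "finite F" "F \<subseteq> carrier G" for F
  proof -
    have "(\<Sum>x\<in>F. (cmod (f x + g x))\<^sup>2) \<le> (\<Sum>x\<in>F. 2 * (cmod (f x))\<^sup>2 + 2 * (cmod (g x))\<^sup>2)"
      by (rule sum_mono) (rule cmod_add_power2_le)
    also have "\<dots> \<le> 2 * l2_sq G f + 2 * l2_sq G g"
      using sum_le_l2_sq[OF assms(1) F] sum_le_l2_sq[OF assms(2) F]
      by (simp add: sum.distrib flip: sum_distrib_left)
    finally show ?thesis .
  qed
  show "(\<lambda>x. f x + g x) \<in> l2_space G"
    "l2_sq G (\<lambda>x. f x + g x) \<le> 2 * l2_sq G f + 2 * l2_sq G g"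
    by (rule l2_spaceI[OF _ *]; simp add: l2_space_outside[OF assms(1)] l2_space_outside[OF assms(2)])+
qed

lemma l2_diff_scale:
  assumes "f \<in> l2_space G" "g \<in> l2_space G"
  shows "(\<lambda>x. f x - z * g x) \<in> l2_space G"
  using l2_add(1)[OF assms(1) l2_scale(1)[OF assms(2), of "-z"]] by simp

lemma l2_bounded_operatorI:
  assumes "\<And>f. f \<in> l2_space G \<Longrightarrow> T f \<in> l2_space G"
    and "\<And>f g. f \<in> l2_space G \<Longrightarrow> g \<in> l2_space G \<Longrightarrow> T (\<lambda>x. f x + g x) = (\<lambda>x. T f x + T g x)"
    and "\<And>z f. f \<in> l2_space G \<Longrightarrow> T (\<lambda>x. z * f x) = (\<lambda>x. z * T f x)"
    and C: "\<And>f. f \<in> l2_space G \<Longrightarrow> l2_sq G (T f) \<le> C * l2_sq G f"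
  shows "l2_bounded_operator G T"
proof -
  have "l2_norm G (T f) \<le> sqrt \<bar>C\<bar> * l2_norm G f" if "f \<in> l2_space G" for f
  proof -
    have "l2_sq G (T f) \<le> \<bar>C\<bar> * l2_sq G f"
      using C[OF that] mult_right_mono[of C "\<bar>C\<bar>" "l2_sq G f"] l2_sq_nonneg[of G f] by linarith
    then have "sqrt (l2_sq G (T f)) \<le> sqrt (\<bar>C\<bar> * l2_sq G f)" by simp
    then show ?thesis by (simp add: l2_norm_def l2_sq_def real_sqrt_mult)
  qed
  then show ?thesis using assms(1-3) unfolding l2_bounded_operator_def by blast
qed

lemma l2_bounded_operatorD:
  assumes "l2_bounded_operator G T"
  shows "f \<in> l2_space G \<Longrightarrow> T f \<in> l2_space G"
    and "f \<in> l2_space G \<Longrightarrow> g \<in> l2_space G \<Longrightarrow> T (\<lambda>x. f x + g x) = (\<lambda>x. T f x + T g x)"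
    and "f \<in> l2_space G \<Longrightarrow> T (\<lambda>x. z * f x) = (\<lambda>x. z * T f x)"
    and "f \<in> l2_space G \<Longrightarrow> g \<in> l2_space G \<Longrightarrow> T (\<lambda>x. f x - z * g x) = (\<lambda>x. T f x - z * T g x)"
    and "\<exists>C>0. \<forall>f\<in>l2_space G. l2_sq G (T f) \<le> C * l2_sq G f"
proof -
  note T = assms[unfolded l2_bounded_operator_def]
  show "f \<in> l2_space G \<Longrightarrow> T f \<in> l2_space G"
    and add: "f \<in> l2_space G \<Longrightarrow> g \<in> l2_space G \<Longrightarrow> T (\<lambda>x. f x + g x) = (\<lambda>x. T f x + T g x)" for f g
    using T by auto
  show sc: "f \<in> l2_space G \<Longrightarrow> T (\<lambda>x. z * f x) = (\<lambda>x. z * T f x)" for z f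
    using T by auto
  show "f \<in> l2_space G \<Longrightarrow> g \<in> l2_space G \<Longrightarrow> T (\<lambda>x. f x - z * g x) = (\<lambda>x. T f x - z * T g x)"
    using add[of f "\<lambda>x. - z * g x"] sc[of g "-z"] l2_scale(1)[of g G "-z"] by simp
  from T obtain C where C: "\<forall>f\<in>l2_space G. l2_norm G (T f) \<le> C * l2_norm G f"
    by (elim conjE exE)
  have "l2_sq G (T f) \<le> (C\<^sup>2 + 1) * l2_sq G f" if "f \<in> l2_space G" for f
  proof -
    have "l2_sq G (T f) \<le> (C * l2_norm G f)\<^sup>2"
      unfolding l2_norm_power2[symmetric] by (intro power_mono C[rule_format] that l2_norm_nonneg)
    also have "\<dots> \<le> (C\<^sup>2 + 1) * l2_sq G f"
      using l2_sq_nonneg[of G f] by (simp add: power_mult_distrib l2_norm_power2 algebra_simps)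
    finally show ?thesis .
  qed
  then show "\<exists>C>0. \<forall>f\<in>l2_space G. l2_sq G (T f) \<le> C * l2_sq G f"
    by (intro exI[of _ "C\<^sup>2 + 1"]) (auto intro: add_nonneg_pos)
qed

lemma bounded_scale:
  assumes "l2_bounded_operator G T"
  shows "l2_bounded_operator G (\<lambda>f x. z * T f x)"
proof -
  note T = l2_bounded_operatorD[OF assms]
  obtain C where C: "\<forall>f\<in>l2_space G. l2_sq G (T f) \<le> C * l2_sq G f" using T(5) by auto
  show ?thesis
  proof (rule l2_bounded_operatorI[where C = "(cmod z)\<^sup>2 * C"])
    fix f assume "f \<in> l2_space G"
    then show "l2_sq G (\<lambda>x. z * T f x) \<le> (cmod z)\<^sup>2 * C * l2_sq G f"
      using C T(1) by (simp add: l2_scale mult.assoc mult_left_mono)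
  qed (auto simp: T l2_scale algebra_simps)
qed

lemma bounded_add:
  assumes "l2_bounded_operator G T" "l2_bounded_operator G S"
  shows "l2_bounded_operator G (\<lambda>f x. T f x + S f x)"
proof -
  note T = l2_bounded_operatorD[OF assms(1)] and S = l2_bounded_operatorD[OF assms(2)]
  obtain C where C: "\<forall>f\<in>l2_space G. l2_sq G (T f) \<le> C * l2_sq G f" using T(5) by auto
  obtain D where D: "\<forall>f\<in>l2_space G. l2_sq G (S f) \<le> D * l2_sq G f" using S(5) by auto
  show ?thesis
  proof (rule l2_bounded_operatorI[where C = "2 * C + 2 * D"])
    fix f assume f: "f \<in> l2_space G"
    have "l2_sq G (\<lambda>x. T f x + S f x) \<le> 2 * l2_sq G (T f) + 2 * l2_sq G (S f)"
      using f by (intro l2_add T S)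
    also have "\<dots> \<le> 2 * (C * l2_sq G f) + 2 * (D * l2_sq G f)"
      using C D f by (intro add_mono mult_left_mono) auto
    finally show "l2_sq G (\<lambda>x. T f x + S f x) \<le> (2 * C + 2 * D) * l2_sq G f"
      by (simp add: algebra_simps)
  qed (auto simp: T S l2_add algebra_simps)
qed

lemma bounded_compose:
  assumes "l2_bounded_operator G T" "l2_bounded_operator G S"
  shows "l2_bounded_operator G (\<lambda>f. T (S f))"
proof -
  note T = l2_bounded_operatorD[OF assms(1)] and S = l2_bounded_operatorD[OF assms(2)]
  obtain C where C: "C > 0" "\<forall>f\<in>l2_space G. l2_sq G (T f) \<le> C * l2_sq G f" using T(5) by auto
  obtain D where D: "\<forall>f\<in>l2_space G. l2_sq G (S f) \<le> D * l2_sq G f" using S(5) by auto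
  show ?thesis
  proof (rule l2_bounded_operatorI[where C = "C * D"])
    fix f assume f: "f \<in> l2_space G"
    have "l2_sq G (T (S f)) \<le> C * l2_sq G (S f)" using C f S by simp
    also have "\<dots> \<le> C * (D * l2_sq G f)" using C D f by (simp add: mult_left_mono)
    finally show "l2_sq G (T (S f)) \<le> C * D * l2_sq G f" by (simp add: mult.assoc)
  qed (auto simp: T S l2_add l2_scale)
qed

lemma bounded_id: "l2_bounded_operator G (\<lambda>f. f)"
  by (rule l2_bounded_operatorI[where C = 1]) auto

text \<open>
  Continuity along pointwise limits inside \<open>l\<^sup>2\<close>, with no rate and no convergence in norm. It holds for
  finite combinations of translations and allows such an operator to be applied to a pointwise
  convergent series term by term.
\<close>

definition pointwise_continuous ::
    "('a, 'm) monoid_scheme \<Rightarrow> (('a \<Rightarrow> complex) \<Rightarrow> ('a \<Rightarrow> complex)) \<Rightarrow> bool" where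
  "pointwise_continuous G T \<longleftrightarrow>
     (\<forall>F h. (\<forall>n::nat. F n \<in> l2_space G) \<longrightarrow> h \<in> l2_space G \<longrightarrow> (\<forall>x. (\<lambda>n. F n x) \<longlonglongrightarrow> h x) \<longrightarrow>
        (\<forall>x. (\<lambda>n. T (F n) x) \<longlonglongrightarrow> T h x))"

definition local_operator ::
    "('a, 'm) monoid_scheme \<Rightarrow> (('a \<Rightarrow> complex) \<Rightarrow> ('a \<Rightarrow> complex)) \<Rightarrow> bool" where
  "local_operator G T \<longleftrightarrow> l2_bounded_operator G T \<and> pointwise_continuous G T"

lemma local_id: "local_operator G (\<lambda>f. f)"
  by (simp add: local_operator_def bounded_id pointwise_continuous_def)

lemma local_scale: "local_operator G T \<Longrightarrow> local_operator G (\<lambda>f x. z * T f x)"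
  by (auto simp: local_operator_def bounded_scale pointwise_continuous_def intro!: tendsto_mult tendsto_add)

lemma local_add:
  "local_operator G T \<Longrightarrow> local_operator G S \<Longrightarrow> local_operator G (\<lambda>f x. T f x + S f x)"
  by (auto simp: local_operator_def bounded_add pointwise_continuous_def intro!: tendsto_mult tendsto_add)

lemma local_compose:
  "local_operator G T \<Longrightarrow> local_operator G S \<Longrightarrow> local_operator G (\<lambda>f. T (S f))"
  by (simp add: local_operator_def bounded_compose pointwise_continuous_def l2_bounded_operatorD(1))

definition translate :: "('a, 'm) monoid_scheme \<Rightarrow> 'a \<Rightarrow> ('a \<Rightarrow> complex) \<Rightarrow> 'a \<Rightarrow> complex" where
  "translate G h f = (\<lambda>g. if g \<in> carrier G then f (inv\<^bsub>G\<^esub> h \<otimes>\<^bsub>G\<^esub> g) else 0)"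

lemma (in group) bij_betw_left_mult:
  assumes "h \<in> carrier G" shows "bij_betw (\<lambda>g. h \<otimes> g) (carrier G) (carrier G)"
  by (rule bij_betw_byWitness[of _ "\<lambda>g. inv h \<otimes> g"]) (use assms in \<open>auto simp: m_assoc[symmetric]\<close>)

lemma (in group) translate_l2:
  assumes "h \<in> carrier G" "f \<in> l2_space G"
  shows "translate G h f \<in> l2_space G" "l2_sq G (translate G h f) = l2_sq G f"
proof -
  have b: "bij_betw (\<lambda>g. inv h \<otimes> g) (carrier G) (carrier G)"
    using assms by (simp add: bij_betw_left_mult)
  have "(\<lambda>x. (cmod (f x))\<^sup>2) summable_on carrier G" using assms by (simp add: l2_space_def)
  with summable_on_reindex_bij_betw[OF b, of "\<lambda>x. (cmod (f x))\<^sup>2"]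
  have "(\<lambda>x. (cmod (translate G h f x))\<^sup>2) summable_on carrier G"
    by (simp add: translate_def cong: summable_on_cong)
  then show "translate G h f \<in> l2_space G" by (simp add: l2_space_def translate_def)
  show "l2_sq G (translate G h f) = l2_sq G f"
    using infsum_reindex_bij_betw[OF b, of "\<lambda>x. (cmod (f x))\<^sup>2"]
    by (simp add: translate_def l2_sq_def cong: infsum_cong)
qed

lemma (in group) local_translate:
  assumes "h \<in> carrier G" shows "local_operator G (translate G h)"
  unfolding local_operator_def
proof
  show "l2_bounded_operator G (translate G h)"
    by (rule l2_bounded_operatorI[where C = 1])
       (use assms in \<open>auto simp: translate_l2 fun_eq_iff\<close>, auto simp: translate_def)
  show "pointwise_continuous G (translate G h)"
    by (auto simp: pointwise_continuous_def translate_def)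
qed

section \<open>Neumann series\<close>

lemma funpow_l2:
  assumes T: "l2_bounded_operator G T"
    and contr: "\<And>f. f \<in> l2_space G \<Longrightarrow> l2_sq G (T f) \<le> l2_sq G f"
    and f: "f \<in> l2_space G"
  shows "(T ^^ n) f \<in> l2_space G" "l2_sq G ((T ^^ n) f) \<le> l2_sq G f"
proof (induction n)
  case (Suc n)
  show "(T ^^ Suc n) f \<in> l2_space G" using Suc by (simp add: l2_bounded_operatorD(1)[OF T])
  show "l2_sq G ((T ^^ Suc n) f) \<le> l2_sq G f" using Suc contr[of "(T ^^ n) f"] by simp
qed (use f in auto)

lemma cauchy_schwarz_weighted:
  fixes c :: "nat \<Rightarrow> complex" and q :: complex
  shows "(cmod (\<Sum>n<N. q ^ n * c n))\<^sup>2 \<le> (\<Sum>n<N. cmod q ^ n) * (\<Sum>n<N. cmod q ^ n * (cmod (c n))\<^sup>2)"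
proof -
  have "cmod (\<Sum>n<N. q ^ n * c n) \<le> (\<Sum>n<N. sqrt (cmod q ^ n) * (sqrt (cmod q ^ n) * cmod (c n)))"
    by (rule order_trans[OF norm_sum]) (simp add: norm_mult norm_power mult.assoc[symmetric])
  then have "(cmod (\<Sum>n<N. q ^ n * c n))\<^sup>2
      \<le> (\<Sum>n<N. sqrt (cmod q ^ n) * (sqrt (cmod q ^ n) * cmod (c n)))\<^sup>2"
    by (intro power_mono norm_ge_zero)
  also have "\<dots> \<le> (\<Sum>n<N. (sqrt (cmod q ^ n))\<^sup>2) * (\<Sum>n<N. (sqrt (cmod q ^ n) * cmod (c n))\<^sup>2)"
    by (rule Cauchy_Schwarz_ineq_sum)
  finally show ?thesis by (simp add: power_mult_distrib)
qed

text \<open>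
  The solution is \<open>\<Sum>n. q\<^sup>n T\<^sup>n f\<close>, summed pointwise. The weighted Cauchy-Schwarz inequality gives
  the \<open>l\<^sup>2\<close> bound for the partial sums, and it survives the pointwise limit on finite sets of points.
\<close>

lemma neumann_solution:
  assumes T: "local_operator G T"
    and contr: "\<And>f. f \<in> l2_space G \<Longrightarrow> l2_sq G (T f) \<le> l2_sq G f"
    and q: "cmod q < 1" and f: "f \<in> l2_space G"
  obtains h where "h \<in> l2_space G" "l2_sq G h \<le> (1 / (1 - cmod q))\<^sup>2 * l2_sq G f"
    "\<And>x. h x - q * T h x = f x"
proof -
  have bT: "l2_bounded_operator G T" and pT: "pointwise_continuous G T"
    using T by (auto simp: local_operator_def)
  note lin = l2_bounded_operatorD[OF bT]
  note P = funpow_l2[OF bT contr f, simplified]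
  define K where "K = sqrt (l2_sq G f)"
  define s where "s = 1 / (1 - cmod q)"
  have geo: "(\<Sum>n<N. cmod q ^ n) \<le> s" for N
  proof -
    have "(\<Sum>n<N. cmod q ^ n) \<le> suminf (\<lambda>n. cmod q ^ n)"
      using q by (intro sum_le_suminf summable_geometric) auto
    then show ?thesis using q by (simp add: s_def suminf_geometric)
  qed
  have s0: "0 \<le> s" using q by (simp add: s_def)
  define B where "B N x = (\<Sum>n<N. q ^ n * (T ^^ n) f x)" for N x
  define h where "h x = suminf (\<lambda>n. q ^ n * (T ^^ n) f x)" for x
  have "summable (\<lambda>n. q ^ n * (T ^^ n) f x)" for x
  proof (rule summable_comparison_test'[of "\<lambda>n. cmod q ^ n * K" 0])
    show "summable (\<lambda>n. cmod q ^ n * K)" using q by (intro summable_mult2 summable_geometric) auto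
    fix n
    have "(cmod ((T ^^ n) f x))\<^sup>2 \<le> l2_sq G f"
      using norm_le_l2_sq[OF P(1), of n x] P(2)[of n] by linarith
    then have "cmod ((T ^^ n) f x) \<le> K" unfolding K_def by (rule real_le_rsqrt)
    then show "norm (q ^ n * (T ^^ n) f x) \<le> cmod q ^ n * K"
      by (simp add: norm_mult norm_power mult_left_mono)
  qed
  then have lim: "(\<lambda>N. B N x) \<longlonglongrightarrow> h x" for x
    unfolding B_def h_def by (rule summable_LIMSEQ)
  have bound: "(\<Sum>x\<in>F. (cmod (B N x))\<^sup>2) \<le> s\<^sup>2 * l2_sq G f" if F: "finite F" "F \<subseteq> carrier G" for F N
  proof -
    have "(\<Sum>x\<in>F. (cmod (B N x))\<^sup>2) \<le> (\<Sum>x\<in>F. s * (\<Sum>n<N. cmod q ^ n * (cmod ((T ^^ n) f x))\<^sup>2))"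
      unfolding B_def
      by (intro sum_mono order_trans[OF cauchy_schwarz_weighted] mult_right_mono geo sum_nonneg) auto
    also have "\<dots> = s * (\<Sum>n<N. cmod q ^ n * (\<Sum>x\<in>F. (cmod ((T ^^ n) f x))\<^sup>2))"
      by (simp add: sum_distrib_left sum.swap[of _ _ F])
    also have "\<dots> \<le> s * (\<Sum>n<N. cmod q ^ n * l2_sq G f)"
      using s0 by (intro mult_left_mono sum_mono order_trans[OF sum_le_l2_sq[OF P(1) F] P(2)]) auto
    also have "\<dots> \<le> s * (s * l2_sq G f)"
      using s0 geo by (intro mult_left_mono) (auto simp: l2_sq_nonneg mult_right_mono simp flip: sum_distrib_right)
    finally show ?thesis by (simp add: power2_eq_square mult.assoc)
  qed
  have out: "B N x = 0" if "x \<notin> carrier G" for N x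
    using l2_space_outside[OF P(1) that] by (simp add: B_def)
  have BL: "B N \<in> l2_space G" for N
    by (rule l2_spaceI(1)[OF out bound])
  have hb: "(\<Sum>x\<in>F. (cmod (h x))\<^sup>2) \<le> s\<^sup>2 * l2_sq G f" if F: "finite F" "F \<subseteq> carrier G" for F
    by (rule LIMSEQ_le_const2[of "\<lambda>N. \<Sum>x\<in>F. (cmod (B N x))\<^sup>2"])
       (use bound[OF F] in \<open>auto intro!: tendsto_sum tendsto_power tendsto_norm lim\<close>)
  have ho: "h x = 0" if "x \<notin> carrier G" for x
    using l2_space_outside[OF P(1) that] by (simp add: h_def)
  have hL: "h \<in> l2_space G" "l2_sq G h \<le> s\<^sup>2 * l2_sq G f"
    by (rule l2_spaceI[OF ho hb]; assumption)+
  \<comment> \<open>The recursion of the partial sums turns into the equation for \<open>h\<close> in the limit.\<close>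
  have step: "B (Suc N) x = f x + q * T (B N) x" for N x
  proof (induction N arbitrary: x)
    case 0
    have "B 0 = (\<lambda>x. 0 * f x)" by (simp add: B_def fun_eq_iff)
    then have "T (B 0) x = 0" using lin(3)[OF f, of 0] by simp
    then show ?case using B_def[of 1 x] by simp
  next
    case (Suc N)
    have "B (Suc N) = (\<lambda>x. B N x + q ^ N * (T ^^ N) f x)" by (simp add: B_def fun_eq_iff)
    then have "T (B (Suc N)) = (\<lambda>x. T (B N) x + q ^ N * (T ^^ Suc N) f x)"
      using lin(2)[OF BL l2_scale(1)[OF P(1)]] lin(3)[OF P(1)] by simp
    moreover have "B (Suc (Suc N)) x = B (Suc N) x + q ^ Suc N * (T ^^ Suc N) f x"
      unfolding B_def by (rule sum.lessThan_Suc)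
    ultimately show ?case using Suc[of x] by (simp add: algebra_simps)
  qed
  have "h x = f x + q * T h x" for x
  proof (rule LIMSEQ_unique)
    show "(\<lambda>N. B (Suc N) x) \<longlonglongrightarrow> h x" using lim by (rule LIMSEQ_Suc)
    have "(\<lambda>N. T (B N) x) \<longlonglongrightarrow> T h x"
      using pT BL hL(1) lim unfolding pointwise_continuous_def by blast
    then show "(\<lambda>N. B (Suc N) x) \<longlonglongrightarrow> f x + q * T h x"
      unfolding step by (intro tendsto_intros)
  qed
  then have "h x - q * T h x = f x" for x by (metis add_diff_cancel_right')
  then show ?thesis using that hL by (simp add: s_def)
qed

text \<open>
  A solution of \<open>f = qTf\<close> satisfies \<open>\<parallel>f\<parallel> \<le> |q| \<parallel>f\<parallel>\<close>.
\<close>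

lemma neumann_injective:
  assumes T: "l2_bounded_operator G T"
    and contr: "\<And>f. f \<in> l2_space G \<Longrightarrow> l2_sq G (T f) \<le> l2_sq G f"
    and q: "cmod q < 1" and f: "f \<in> l2_space G" and eq: "\<And>x. f x - q * T f x = 0"
  shows "f x = 0"
proof -
  have "f = (\<lambda>x. q * T f x)" using eq by (simp add: fun_eq_iff)
  then have "l2_sq G f = (cmod q)\<^sup>2 * l2_sq G (T f)"
    using l2_scale(2)[OF l2_bounded_operatorD(1)[OF T f], of q] by simp
  also have "\<dots> \<le> (cmod q)\<^sup>2 * l2_sq G f" by (intro mult_left_mono contr f) auto
  finally have "(1 - (cmod q)\<^sup>2) * l2_sq G f \<le> 0" by (simp add: algebra_simps)
  moreover have "(cmod q)\<^sup>2 < 1" using q by (simp add: power_less_one_iff)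
  ultimately have "l2_sq G f \<le> 0" by (simp add: mult_le_0_iff)
  then have "(cmod (f x))\<^sup>2 \<le> 0" using norm_le_l2_sq[OF f, of x] by linarith
  then show ?thesis by simp
qed

section \<open>The spectrum of a combination of two involutions\<close>

text \<open>
  Solvability with a uniform bound and injectivity suffice, since uniqueness makes the choice of
  solutions linear.
\<close>

lemma not_in_l2_spectrumI:
  assumes T: "l2_bounded_operator G T"
    and solve: "\<And>f. f \<in> l2_space G \<Longrightarrow>
      \<exists>h\<in>l2_space G. (\<lambda>x. T h x - z * h x) = f \<and> l2_sq G h \<le> C * l2_sq G f"
    and inj: "\<And>f. f \<in> l2_space G \<Longrightarrow> (\<And>x. T f x - z * f x = 0) \<Longrightarrow> f = (\<lambda>x. 0)"
  shows "z \<notin> l2_spectrum G T"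
proof -
  note lin = l2_bounded_operatorD[OF T]
  define R where "R f = (SOME h. h \<in> l2_space G \<and> (\<lambda>x. T h x - z * h x) = f \<and> l2_sq G h \<le> C * l2_sq G f)" for f
  have R: "R f \<in> l2_space G" "(\<lambda>x. T (R f) x - z * R f x) = f" "l2_sq G (R f) \<le> C * l2_sq G f"
    if "f \<in> l2_space G" for f
    using someI_ex[of "\<lambda>h. h \<in> l2_space G \<and> (\<lambda>x. T h x - z * h x) = f \<and> l2_sq G h \<le> C * l2_sq G f"]
      solve[OF that] unfolding R_def by auto
  have uniq: "g = h" if g: "g \<in> l2_space G" and h: "h \<in> l2_space G"
      and eq: "(\<lambda>x. T g x - z * g x) = (\<lambda>x. T h x - z * h x)" for g h
  proof -
    have "(\<lambda>x. g x - 1 * h x) = (\<lambda>x. 0)"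
    proof (rule inj)
      show "(\<lambda>x. g x - 1 * h x) \<in> l2_space G" by (intro l2_diff_scale g h)
      fix x
      show "T (\<lambda>x. g x - 1 * h x) x - z * (g x - 1 * h x) = 0"
        using fun_cong[OF eq, of x] by (simp only: lin(4)[OF g h]) (simp add: algebra_simps)
    qed
    then show ?thesis by (simp add: fun_eq_iff)
  qed
  have R_eqI: "R f = h" if "f \<in> l2_space G" "h \<in> l2_space G" "(\<lambda>x. T h x - z * h x) = f" for f h
    by (rule uniq) (use that R[of f] in auto)
  have Rx: "T (R f) x - z * R f x = f x" if "f \<in> l2_space G" for f x
    using R(2)[OF that] by (rule fun_cong)
  have "l2_bounded_operator G R"
  proof (rule l2_bounded_operatorI[where C = C])
    fix f g assume fg: "f \<in> l2_space G" "g \<in> l2_space G"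
    show "R (\<lambda>x. f x + g x) = (\<lambda>x. R f x + R g x)"
    proof (rule R_eqI)
      show "(\<lambda>x. T (\<lambda>x. R f x + R g x) x - z * (R f x + R g x)) = (\<lambda>x. f x + g x)"
        using Rx[OF fg(1)] Rx[OF fg(2)] by (simp add: lin(2) R fg fun_eq_iff algebra_simps)
    qed (intro l2_add R fg)+
  next
    fix f u assume f: "f \<in> l2_space G"
    show "R (\<lambda>x. u * f x) = (\<lambda>x. u * R f x)"
    proof (rule R_eqI)
      show "(\<lambda>x. T (\<lambda>x. u * R f x) x - z * (u * R f x)) = (\<lambda>x. u * f x)"
      proof
        fix x
        show "T (\<lambda>x. u * R f x) x - z * (u * R f x) = u * f x"
          using Rx[OF f, of x] lin(3)[OF R(1)[OF f], of u]
          by (simp add: right_diff_distrib[symmetric] mult.left_commute[of z u])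
      qed
    qed (intro l2_scale R f)+
  next
    show "R f \<in> l2_space G" "l2_sq G (R f) \<le> C * l2_sq G f" if "f \<in> l2_space G" for f
      using R(1,3)[OF that] by auto
  qed
  moreover have "R (\<lambda>x. T f x - z * f x) = f" if "f \<in> l2_space G" for f
    by (rule R_eqI[OF _ that refl]) (intro l2_diff_scale lin(1) that)
  ultimately show ?thesis unfolding l2_spectrum_def using R(2) by blast
qed

text \<open>
  The roots of \<open>q\<^sup>2 - cq + 1\<close> have product 1, so one of them lies inside the unit disc unless both lie
  on the circle; in that case they are conjugate and \<open>c\<close> is twice their real part.
\<close>

lemma joukowski_solution:
  fixes c :: complex
  assumes "c \<notin> complex_of_real ` {-2..2}"
  obtains q where "q \<noteq> 0" "cmod q < 1" "1 + q\<^sup>2 = c * q"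
proof -
  define s where "s = csqrt (c\<^sup>2 - 4)"
  define p where "p = (c + s) / 2"
  have ss: "s\<^sup>2 = c\<^sup>2 - 4" by (simp add: s_def)
  have "s = 2 * p - c" by (simp add: p_def field_simps)
  with ss have "4 * (1 + p\<^sup>2) = 4 * (c * p)" by (simp add: power2_eq_square algebra_simps)
  then have p: "1 + p\<^sup>2 = c * p" by (subst (asm) mult_cancel_left) simp
  then have p0: "p \<noteq> 0" by auto
  have c: "c = p + inverse p" using p p0 by (simp add: field_simps power2_eq_square)
  consider "cmod p < 1" | "cmod p > 1" | "cmod p = 1" by linarith
  then show ?thesis
  proof cases
    case 1
    then show ?thesis using that p p0 by blast
  next
    case 2
    show ?thesis
    proof (rule that[of "inverse p"])
      show "cmod (inverse p) < 1" using 2 by (simp add: norm_inverse inverse_less_1_iff)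
      show "1 + (inverse p)\<^sup>2 = c * inverse p" using p0 by (simp add: c field_simps power2_eq_square)
    qed (use p0 in auto)
  next
    case 3
    then have "inverse p = cnj p"
      using complex_norm_square[of p] p0 by (simp add: field_simps)
    then have "c = complex_of_real (2 * Re p)" by (simp add: c complex_add_cnj)
    moreover have "\<bar>Re p\<bar> \<le> 1" using abs_Re_le_cmod[of p] 3 by simp
    ultimately have "c \<in> complex_of_real ` {-2..2}" by (intro image_eqI[of _ _ "2 * Re p"]) auto
    then show ?thesis using assms by contradiction
  qed
qed

text \<open>
  Here \<open>w = 4z - 1\<close> is the parameter of \<open>a + 2U\<close>, and \<open>(w\<^sup>2 - 5) / 2\<close> that of \<open>V + V\<inverse>\<close>.
\<close>

lemma spectral_parameter:
  fixes z :: complex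
  assumes "((4 * z - 1)\<^sup>2 - 5) / 2 \<in> complex_of_real ` {-2..2}"
  shows "z \<in> complex_of_real ` ({-1/2..0} \<union> {1/2..1})"
proof -
  define w where "w = 4 * z - 1"
  from assms obtain t where t: "-2 \<le> t" "t \<le> 2" "(w\<^sup>2 - 5) / 2 = complex_of_real t"
    unfolding w_def by auto
  define r where "r = sqrt (2 * t + 5)"
  have "r \<le> sqrt (3\<^sup>2)" unfolding r_def by (rule real_sqrt_le_mono) (use t in simp)
  then have r: "1 \<le> r" "r \<le> 3" "r\<^sup>2 = 2 * t + 5"
    using t by (auto simp: r_def)
  have "w\<^sup>2 = complex_of_real (2 * t + 5)" using t(3) by (simp add: field_simps)
  then have "w\<^sup>2 = (complex_of_real r)\<^sup>2" using r(3) by (metis of_real_power)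
  then have "w = complex_of_real r \<or> w = - complex_of_real r" by (simp add: power2_eq_iff)
  then have "z = complex_of_real ((1 + r) / 4) \<or> z = complex_of_real ((1 - r) / 4)"
    unfolding w_def by (auto simp: field_simps)
  moreover have "(1 + r) / 4 \<in> {-1/2..0} \<union> {1/2..1}" "(1 - r) / 4 \<in> {-1/2..0} \<union> {1/2..1}"
    using r(1,2) by auto
  ultimately show ?thesis by blast
qed

text \<open>
  With \<open>S\<^sub>v = A + 2U + v\<close> one has \<open>4(T - z) = S\<^sub>-\<^sub>w\<close>, and \<open>S\<^sub>-\<^sub>w\<close> and \<open>S\<^sub>w\<close> commute with
  product \<open>5 - w\<^sup>2 + 2(AU + UA)\<close>, a multiple of \<open>D = (1 - qAU)(1 - qUA)\<close>. Invertibility of the two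
  factors of \<open>D\<close> therefore gives solutions (by applying \<open>S\<^sub>w\<close> to a solution of \<open>Dh = f\<close>) as well as
  injectivity.
\<close>

lemma two_involutions_spectrum:
  assumes A: "local_operator G A" and U: "local_operator G U"
    and AA: "\<And>f. f \<in> l2_space G \<Longrightarrow> A (A f) = f" and UU: "\<And>f. f \<in> l2_space G \<Longrightarrow> U (U f) = f"
    and cA: "\<And>f. f \<in> l2_space G \<Longrightarrow> l2_sq G (A f) \<le> l2_sq G f"
    and cU: "\<And>f. f \<in> l2_space G \<Longrightarrow> l2_sq G (U f) \<le> l2_sq G f"
    and T: "l2_bounded_operator G T"
    and TAU: "\<And>f x. f \<in> l2_space G \<Longrightarrow> T f x = (A f x + 2 * U f x + f x) / 4"
  shows "l2_spectrum G T \<subseteq> complex_of_real ` ({-1/2..0} \<union> {1/2..1})"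
proof
  fix z assume z: "z \<in> l2_spectrum G T"
  show "z \<in> complex_of_real ` ({-1/2..0} \<union> {1/2..1})"
  proof (rule ccontr)
    assume "z \<notin> complex_of_real ` ({-1/2..0} \<union> {1/2..1})"
    define w where "w = 4 * z - 1"
    have "(w\<^sup>2 - 5) / 2 \<notin> complex_of_real ` {-2..2}"
      using spectral_parameter[of z] \<open>z \<notin> _\<close> unfolding w_def by blast
    then obtain q where q: "q \<noteq> 0" "cmod q < 1" "1 + q\<^sup>2 = (w\<^sup>2 - 5) / 2 * q"
      by (rule joukowski_solution)
    have bA: "l2_bounded_operator G A" and bU: "l2_bounded_operator G U"
      using A U by (auto simp: local_operator_def)
    note a = l2_bounded_operatorD[OF bA] and u = l2_bounded_operatorD[OF bU]
    define S where "S v f x = A f x + 2 * U f x + v * f x" for v f x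
    have bS: "l2_bounded_operator G (S v)" for v
      unfolding S_def[abs_def] by (rule bounded_add[OF bounded_add[OF bA bounded_scale[OF bU]] bounded_scale[OF bounded_id]])
    note s = l2_bounded_operatorD[OF bS]
    have lV: "local_operator G (\<lambda>f. A (U f))" and lW: "local_operator G (\<lambda>f. U (A f))"
      using local_compose[OF A U] local_compose[OF U A] .
    have cV: "l2_sq G (A (U f)) \<le> l2_sq G f" and cW: "l2_sq G (U (A f)) \<le> l2_sq G f"
      if "f \<in> l2_space G" for f
      by (rule order_trans[OF cA[OF u(1)[OF that]] cU[OF that]])
         (rule order_trans[OF cU[OF a(1)[OF that]] cA[OF that]])
    note bV = lV[unfolded local_operator_def, THEN conjunct1]
      and bW = lW[unfolded local_operator_def, THEN conjunct1]
    define D where "D f x = (f x - q * U (A f) x) - q * A (U (\<lambda>x. f x - q * U (A f) x)) x" for f x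
    have D: "D f x = (1 + q\<^sup>2) * f x - q * A (U f) x - q * U (A f) x" if f: "f \<in> l2_space G" for f x
    proof -
      have "A (U (\<lambda>x. f x - q * U (A f) x)) = (\<lambda>x. A (U f) x - q * A (U (U (A f))) x)"
        using f a(1) u(1) l2_bounded_operatorD(4)[OF bV f, of "U (A f)" q] by simp
      also have "\<dots> = (\<lambda>x. A (U f) x - q * f x)" using f by (simp add: UU AA a(1))
      finally show ?thesis unfolding D_def by (simp add: power2_eq_square algebra_simps)
    qed
    have SS: "S (-v) (S v f) x = - 2 / q * D f x" if f: "f \<in> l2_space G" and v: "v\<^sup>2 = w\<^sup>2" for v f x
    proof -
      have Sf: "S v f = (\<lambda>x. (A f x + 2 * U f x) + v * f x)" by (simp add: S_def fun_eq_iff)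
      have m: "A f \<in> l2_space G" "U f \<in> l2_space G" using f a(1) u(1) by auto
      have "A (S v f) = (\<lambda>x. f x + 2 * A (U f) x + v * A f x)"
        unfolding Sf using f m by (simp add: a(2,3) l2_add l2_scale AA)
      moreover have "U (S v f) = (\<lambda>x. U (A f) x + 2 * f x + v * U f x)"
        unfolding Sf using f m by (simp add: u(2,3) l2_add l2_scale UU)
      ultimately have "S (-v) (S v f) x = (5 - v\<^sup>2) * f x + 2 * A (U f) x + 2 * U (A f) x"
        by (simp add: S_def power2_eq_square algebra_simps)
      also have "5 - v\<^sup>2 = - 2 / q * (1 + q\<^sup>2)" using q(1) unfolding v q(3) by (simp add: field_simps)
      also have "- 2 / q * (1 + q\<^sup>2) * f x + 2 * A (U f) x + 2 * U (A f) x = - 2 / q * D f x"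
        using q(1) by (simp add: D[OF f] field_simps)
      finally show ?thesis .
    qed
    have TS: "T f x - z * f x = S (-w) f x / 4" if "f \<in> l2_space G" for f x
      using TAU[OF that] by (simp add: S_def w_def field_simps)
    obtain K where K: "K > 0" "\<And>f. f \<in> l2_space G \<Longrightarrow> l2_sq G (S w f) \<le> K * l2_sq G f"
      using s(5)[of w] by auto
    define k where "k = (1 / (1 - cmod q))\<^sup>2"
    have "z \<notin> l2_spectrum G T"
    proof (rule not_in_l2_spectrumI[OF T])
      fix f assume f: "f \<in> l2_space G"
      obtain g where g: "g \<in> l2_space G" "l2_sq G g \<le> k * l2_sq G f"
          "\<And>x. g x - q * A (U g) x = f x"
        using neumann_solution[OF lV cV q(2) f] unfolding k_def by blast
      obtain h where h: "h \<in> l2_space G" "l2_sq G h \<le> k * l2_sq G g"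
          "\<And>x. h x - q * U (A h) x = g x"
        using neumann_solution[OF lW cW q(2) g(1)] unfolding k_def by blast
      have Dh: "D h x = f x" for x unfolding D_def h(3) by (rule g(3))
      define r where "r = (\<lambda>x. -2 * q * S w h x)"
      have r: "r \<in> l2_space G" unfolding r_def by (intro l2_scale s h)
      have "T r x - z * r x = f x" for x
      proof -
        have "S (-w) r x = -2 * q * S (-w) (S w h) x"
          unfolding r_def using s(3)[OF s(1)[OF h(1)]] by (rule fun_cong)
        then show ?thesis using q(1) by (simp add: TS[OF r] SS[OF h(1)] Dh)
      qed
      moreover have "l2_sq G r \<le> (cmod (-2 * q))\<^sup>2 * K * k * k * l2_sq G f"
      proof -
        have "l2_sq G r = (cmod (-2 * q))\<^sup>2 * l2_sq G (S w h)"
          unfolding r_def by (rule l2_scale(2)[OF s(1)[OF h(1)]])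
        also have "\<dots> \<le> (cmod (-2 * q))\<^sup>2 * (K * (k * (k * l2_sq G f)))"
          using K(1) by (intro mult_left_mono order_trans[OF K(2)[OF h(1)]] order_trans[OF h(2)] g(2))
                       (auto simp: k_def)
        finally show ?thesis by (simp add: mult.assoc)
      qed
      ultimately show "\<exists>h\<in>l2_space G. (\<lambda>x. T h x - z * h x) = f \<and>
          l2_sq G h \<le> (cmod (-2 * q))\<^sup>2 * K * k * k * l2_sq G f"
        using r by blast
    next
      fix f assume f: "f \<in> l2_space G" and 0: "\<And>x. T f x - z * f x = 0"
      have "S (-w) f = (\<lambda>x. 0 * f x)" using 0 by (simp add: TS[OF f] fun_eq_iff)
      then have "S w (S (-w) f) = (\<lambda>x. 0)" using s(3)[OF f, of w 0] by simp
      then have "D f x = 0" for x using SS[OF f, of "-w" x] q(1) by simp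
      moreover have "(\<lambda>x. f x - q * U (A f) x) \<in> l2_space G" using f a(1) u(1) by (intro l2_diff_scale) auto
      ultimately have "f x - q * U (A f) x = 0" for x
        using neumann_injective[OF bV cV q(2), of "\<lambda>x. f x - q * U (A f) x"] unfolding D_def by blast
      then show "f = (\<lambda>x. 0)" using neumann_injective[OF bW cW q(2) f] by blast
    qed
    then show False using z by contradiction
  qed
qed

section \<open>From an invariant mean to almost invariant densities\<close>

text \<open>
  If each nonnegative weight has an average of \<open>D v\<close> of at least \<open>\<epsilon>\<close> for some \<open>v\<close>, then a single \<open>u\<close> works
  at all points. Minimise the sum of the squared deficits \<open>max 0 (\<epsilon> - D u g)\<close> over \<open>K\<close> and take the
  deficits at a minimiser as weights \<open>p\<close>: moving from \<open>u\<close> towards the \<open>v\<close> that belongs to \<open>p\<close> would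
  lower the sum if some deficit were positive. The mixing hypothesis replaces convexity of \<open>K\<close> and
  linearity of \<open>D\<close>, so \<open>K\<close> need not live in a vector space.
\<close>

lemma finite_minimax:
  fixes K :: "'b::topological_space set" and D :: "'b \<Rightarrow> 'x \<Rightarrow> real"
  assumes K: "compact K" "K \<noteq> {}" and cont: "\<And>g. continuous_on UNIV (\<lambda>u. D u g)"
    and mix: "\<And>u v t. u \<in> K \<Longrightarrow> v \<in> K \<Longrightarrow> 0 \<le> t \<Longrightarrow> t \<le> 1 \<Longrightarrow>
      \<exists>w\<in>K. \<forall>g. D w g = (1 - t) * D u g + t * D v g"
    and A: "finite A"
    and weights: "\<And>p. (\<And>g. 0 \<le> p g) \<Longrightarrow> (\<And>g. g \<notin> A \<Longrightarrow> p g = 0) \<Longrightarrow>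
      \<exists>v\<in>K. \<epsilon> * sum p A \<le> (\<Sum>g\<in>A. p g * D v g)"
  shows "\<exists>u\<in>K. \<forall>g\<in>A. \<epsilon> \<le> D u g"
proof -
  define J where "J u = (\<Sum>g\<in>A. (max 0 (\<epsilon> - D u g))\<^sup>2)" for u
  have "continuous_on K J"
    unfolding J_def
    by (intro continuous_on_sum continuous_on_power continuous_on_max continuous_on_diff
        continuous_on_const continuous_on_subset[OF cont]) auto
  then obtain u where u: "u \<in> K" and min: "\<And>w. w \<in> K \<Longrightarrow> J u \<le> J w"
    using continuous_attains_inf[OF K] by blast
  define p where "p g = (if g \<in> A then max 0 (\<epsilon> - D u g) else 0)" for g
  obtain v where v: "v \<in> K" "\<epsilon> * sum p A \<le> (\<Sum>g\<in>A. p g * D v g)"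
    using weights[of p] unfolding p_def by (smt (verit))
  define y where "y g = D v g - D u g" for g
  have Ju: "J u = (\<Sum>g\<in>A. (p g)\<^sup>2)" by (simp add: J_def p_def)
  \<comment> \<open>First-order condition at the minimiser, in the direction of \<open>v\<close>.\<close>
  have "2 * (\<Sum>g\<in>A. p g * y g) \<le> t * (\<Sum>g\<in>A. (y g)\<^sup>2)" if t: "0 < t" "t \<le> 1" for t
  proof -
    obtain w where w: "w \<in> K" "\<And>g. D w g = (1 - t) * D u g + t * D v g"
      using mix[OF u v(1), of t] t by auto
    have "J w \<le> (\<Sum>g\<in>A. (p g - t * y g)\<^sup>2)"
      unfolding J_def
    proof (rule sum_mono)
      fix g assume g: "g \<in> A"
      have "max 0 (\<epsilon> - D w g) \<le> \<bar>p g - t * y g\<bar>"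
        using g by (simp add: w p_def y_def algebra_simps)
      then show "(max 0 (\<epsilon> - D w g))\<^sup>2 \<le> (p g - t * y g)\<^sup>2"
        by (metis abs_ge_zero max.cobounded1 power2_abs power_mono)
    qed
    also have "\<dots> = J u - 2 * t * (\<Sum>g\<in>A. p g * y g) + t\<^sup>2 * (\<Sum>g\<in>A. (y g)\<^sup>2)"
      unfolding Ju
      by (simp add: power2_diff power_mult_distrib sum.distrib sum_subtractf sum_distrib_left algebra_simps)
    finally have "t * (2 * (\<Sum>g\<in>A. p g * y g)) \<le> t * (t * (\<Sum>g\<in>A. (y g)\<^sup>2))"
      using min[OF w(1)] by (simp add: power2_eq_square)
    then show ?thesis using t(1) by simp
  qed
  then have "2 * (\<Sum>g\<in>A. p g * y g) \<le> 0"
  proof -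
    assume *: "\<And>t. 0 < t \<Longrightarrow> t \<le> 1 \<Longrightarrow> 2 * (\<Sum>g\<in>A. p g * y g) \<le> t * (\<Sum>g\<in>A. (y g)\<^sup>2)"
    have "((\<lambda>t. t * (\<Sum>g\<in>A. (y g)\<^sup>2)) \<longlongrightarrow> 0 * (\<Sum>g\<in>A. (y g)\<^sup>2)) (at_right 0)"
      by (intro tendsto_intros)
    moreover have "eventually (\<lambda>t. 2 * (\<Sum>g\<in>A. p g * y g) \<le> t * (\<Sum>g\<in>A. (y g)\<^sup>2)) (at_right 0)"
      using * by (intro eventually_at_rightI[of 0 1]) auto
    ultimately show ?thesis by (intro tendsto_lowerbound[of _ _ "at_right 0"]) auto
  qed
  then have "(\<Sum>g\<in>A. p g * D v g) \<le> (\<Sum>g\<in>A. p g * D u g)"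
    by (simp add: y_def algebra_simps sum_subtractf)
  also have "(\<Sum>g\<in>A. p g * D u g) = (\<Sum>g\<in>A. \<epsilon> * p g - (p g)\<^sup>2)"
    by (rule sum.cong) (auto simp: p_def max_def power2_eq_square algebra_simps)
  also have "\<dots> = \<epsilon> * sum p A - (\<Sum>g\<in>A. (p g)\<^sup>2)"
    by (simp add: sum_subtractf sum_distrib_left)
  finally have "(\<Sum>g\<in>A. (p g)\<^sup>2) \<le> 0" using v(2) by linarith
  then have "(\<Sum>g\<in>A. (p g)\<^sup>2) = 0" by (simp add: order.antisym sum_nonneg)
  then have "\<forall>g\<in>A. p g = 0" using A by (simp add: sum_nonneg_eq_0_iff)
  then have "\<forall>g\<in>A. \<epsilon> \<le> D u g" by (auto simp: p_def max_def split: if_splits)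
  then show ?thesis using u by blast
qed

text \<open>
  The conditions \<open>\<epsilon> \<le> D u g\<close> are closed in \<open>u\<close>, so compactness reduces infinitely many of them to
  finitely many.
\<close>

lemma minimax:
  fixes K :: "'b::topological_space set" and D :: "'b \<Rightarrow> 'x \<Rightarrow> real"
  assumes K: "compact K" "K \<noteq> {}" and cont: "\<And>g. continuous_on UNIV (\<lambda>u. D u g)"
    and mix: "\<And>u v t. u \<in> K \<Longrightarrow> v \<in> K \<Longrightarrow> 0 \<le> t \<Longrightarrow> t \<le> 1 \<Longrightarrow>
      \<exists>w\<in>K. \<forall>g. D w g = (1 - t) * D u g + t * D v g"
    and weights: "\<And>p A. finite A \<Longrightarrow> A \<subseteq> Y \<Longrightarrow> (\<And>g. 0 \<le> p g) \<Longrightarrow> (\<And>g. g \<notin> A \<Longrightarrow> p g = 0) \<Longrightarrow>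
      \<exists>v\<in>K. \<epsilon> * sum p A \<le> (\<Sum>g\<in>A. p g * D v g)"
  shows "\<exists>u\<in>K. \<forall>g\<in>Y. \<epsilon> \<le> D u g"
proof -
  have "K \<inter> (\<Inter>g\<in>Y. {u. \<epsilon> \<le> D u g}) \<noteq> {}"
  proof (rule compact_imp_fip_image[OF K(1)])
    show "closed {u. \<epsilon> \<le> D u g}" for g
      by (intro closed_Collect_le continuous_on_const cont)
    fix A assume A: "finite A" "A \<subseteq> Y"
    have "\<exists>u\<in>K. \<forall>g\<in>A. \<epsilon> \<le> D u g"
      by (rule finite_minimax[OF K cont mix A(1) weights[OF A]])
    then show "K \<inter> (\<Inter>g\<in>A. {u. \<epsilon> \<le> D u g}) \<noteq> {}" by blast
  qed
  then show ?thesis by blast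
qed

text \<open>
  Each summand is a translate of a bounded function minus the function itself.
\<close>

lemma (in group) mean_of_divergence:
  assumes m: "left_invariant_mean G m" and S: "finite S" "S \<subseteq> carrier G"
    and u: "\<And>s g. \<bar>u s g\<bar> \<le> C"
  shows "(\<lambda>g. \<Sum>s\<in>S. u s (inv s \<otimes> g) - u s g) \<in> bounded_funs G \<and>
    m (\<lambda>g. \<Sum>s\<in>S. u s (inv s \<otimes> g) - u s g) = 0"
proof -
  note m' = m[unfolded left_invariant_mean_def]
  have bI: "f \<in> bounded_funs G" if "\<And>x. \<bar>f x\<bar> \<le> c" for f and c :: real
    using that by (auto simp: bounded_funs_def bounded_iff)
  have add: "m (\<lambda>x. f x + g x) = m f + m g" if "f \<in> bounded_funs G" "g \<in> bounded_funs G" for f g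
    using m' that by blast
  have scale: "m (\<lambda>x. c * f x) = c * m f" if "f \<in> bounded_funs G" for c f using m' that by blast
  have inv: "m (\<lambda>x. f (inv h \<otimes> x)) = m f" if "f \<in> bounded_funs G" "h \<in> carrier G" for f h
    using m' that by blast
  have ub: "u s \<in> bounded_funs G" "(\<lambda>g. u s (inv s \<otimes> g)) \<in> bounded_funs G"
      "(\<lambda>g. -1 * u s g) \<in> bounded_funs G" for s
    by (rule bI[of _ C]; simp add: u)+
  have one: "m (\<lambda>g. u s (inv s \<otimes> g) - u s g) = 0" if "s \<in> S" for s
    using add[OF ub(2,3), of s] scale[OF ub(1), of "-1"] inv[OF ub(1), of s] that S by auto
  have bound: "(\<lambda>g. \<Sum>s\<in>F. u s (inv s \<otimes> g) - u s g) \<in> bounded_funs G" for F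
  proof (rule bI)
    fix g
    have "\<bar>\<Sum>s\<in>F. u s (inv s \<otimes> g) - u s g\<bar> \<le> (\<Sum>s\<in>F. \<bar>u s (inv s \<otimes> g) - u s g\<bar>)"
      by (rule sum_abs)
    also have "\<dots> \<le> (\<Sum>s\<in>F. 2 * C)"
      by (rule sum_mono) (use u abs_triangle_ineq4 in \<open>smt (verit)\<close>)
    finally show "\<bar>\<Sum>s\<in>F. u s (inv s \<otimes> g) - u s g\<bar> \<le> (\<Sum>s\<in>F. 2 * C)" .
  qed
  have "m (\<lambda>g. \<Sum>s\<in>S. u s (inv s \<otimes> g) - u s g) = 0"
    using S(1) one
  proof (induction S rule: finite_induct)
    case empty
    then show ?case using scale[OF ub(1), of 0] by simp
  next
    case (insert s F)
    have "(\<lambda>g. u s (inv s \<otimes> g) - u s g) \<in> bounded_funs G" using bound[of "{s}"] by simp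
    from add[OF this bound[of F]] insert show ?case by simp
  qed
  with bound show ?thesis by blast
qed

text \<open>
  For \<open>u\<close> in the cube \<open>[-1, 1]\<^bsup>G \<times> G\<^esup>\<close>, compact by Tychonoff's theorem, let
  \<open>D u\<close> be its divergence. Summation by parts pairs \<open>D u\<close> with a density \<open>p\<close> as
  \<open>\<Sum>\<^sub>s \<Sum>\<^sub>g u(s, g) (p(sg) - p(g))\<close>, whose maximum over the cube is the total variation
  \<open>\<Sum>\<^sub>s \<Sum>\<^sub>g |p(sg) - p(g)|\<close>. If this exceeded \<open>\<epsilon>\<close> for all densities, the minimax lemma would yield
  one \<open>u\<close> with \<open>D u \<ge> \<epsilon>\<close> on the whole group, although \<open>D u\<close> has mean zero. The set \<open>B\<close> contains
  the support of \<open>p\<close> and of its translates, so that all sums are finite.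
\<close>

lemma (in group) amenable_imp_reiter:
  assumes am: "amenable G" and S: "finite S" "S \<subseteq> carrier G" and \<epsilon>: "0 < \<epsilon>"
  obtains p B where "\<And>g. (0::real) \<le> p g" "finite B" "B \<subseteq> carrier G" "sum p B = 1"
    "\<And>g. g \<notin> B \<Longrightarrow> p g = 0"
    "\<And>s g. s \<in> S \<Longrightarrow> g \<in> carrier G \<Longrightarrow> g \<notin> B \<Longrightarrow> p (s \<otimes> g) = 0"
    "(\<Sum>s\<in>S. \<Sum>g\<in>B. \<bar>p (s \<otimes> g) - p g\<bar>) \<le> \<epsilon>"
proof (rule ccontr)
  assume "\<not> thesis"
  note witness = that
  define N where "N A = A \<union> (\<Union>s\<in>S. (\<lambda>g. inv s \<otimes> g) ` A)" for A
  have expand: "\<epsilon> * sum p A \<le> (\<Sum>s\<in>S. \<Sum>g\<in>N A. \<bar>p (s \<otimes> g) - p g\<bar>)"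
    if A: "finite A" "A \<subseteq> carrier G" and p: "\<And>g. 0 \<le> p g" "\<And>g. g \<notin> A \<Longrightarrow> p g = 0" for p :: "'a \<Rightarrow> real" and A
  proof (rule ccontr)
    assume less: "\<not> \<epsilon> * sum p A \<le> (\<Sum>s\<in>S. \<Sum>g\<in>N A. \<bar>p (s \<otimes> g) - p g\<bar>)"
    have "0 \<le> (\<Sum>s\<in>S. \<Sum>g\<in>N A. \<bar>p (s \<otimes> g) - p g\<bar>)" by (intro sum_nonneg) auto
    then have "0 < \<epsilon> * sum p A" using less by linarith
    then have P: "0 < sum p A" using \<epsilon> by (simp add: zero_less_mult_iff)
    define c where "c = sum p A"
    have B: "finite (N A)" "N A \<subseteq> carrier G" using A S by (auto simp: N_def)
    show False
    proof (rule \<open>\<not> thesis\<close>[THEN notE], rule witness[of "\<lambda>g. p g / c" "N A"])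
      show "0 \<le> p g / c" for g using p P by (simp add: c_def)
      show "(\<Sum>g\<in>N A. p g / c) = 1"
      proof -
        have "sum p (N A) = c"
          unfolding c_def by (rule sum.mono_neutral_right) (use B p in \<open>auto simp: N_def\<close>)
        then show ?thesis using P by (simp add: c_def flip: sum_divide_distrib)
      qed
      show "p g / c = 0" if "g \<notin> N A" for g using that p(2) by (auto simp: N_def)
      show "p (s \<otimes> g) / c = 0" if "s \<in> S" "g \<in> carrier G" "g \<notin> N A" for s g
      proof -
        have "g = inv s \<otimes> (s \<otimes> g)" using that S by (auto simp: m_assoc[symmetric])
        then have "s \<otimes> g \<notin> A" using that unfolding N_def by blast
        then show ?thesis using p(2) by simp
      qed
      have "(\<Sum>s\<in>S. \<Sum>g\<in>N A. \<bar>p (s \<otimes> g) / c - p g / c\<bar>) = (\<Sum>s\<in>S. \<Sum>g\<in>N A. \<bar>p (s \<otimes> g) - p g\<bar>) / c"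
        using P by (simp add: c_def sum_divide_distrib flip: diff_divide_distrib)
      also have "\<dots> \<le> \<epsilon>" using less P by (simp add: c_def field_simps)
      finally show "(\<Sum>s\<in>S. \<Sum>g\<in>N A. \<bar>p (s \<otimes> g) / c - p g / c\<bar>) \<le> \<epsilon>" .
    qed (use B in auto)
  qed
  define K :: "('a \<times> 'a \<Rightarrow> real) set" where "K = PiE UNIV (\<lambda>_. {-1..1})"
  have Kiff: "u \<in> K \<longleftrightarrow> (\<forall>i. \<bar>u i\<bar> \<le> 1)" for u
    by (auto simp: K_def PiE_iff abs_le_iff minus_le_iff)
  have cK: "compact K"
    using compactin_PiE[of "\<lambda>_. euclidean" "UNIV :: ('a \<times> 'a) set" "\<lambda>_. {-1..1::real}"]
    by (simp add: K_def euclidean_product_topology)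
  have K0: "K \<noteq> {}" using Kiff[of "\<lambda>_. 0"] by auto
  define D where "D u g = (\<Sum>s\<in>S. u (s, inv s \<otimes> g) - u (s, g))" for u :: "'a \<times> 'a \<Rightarrow> real" and g
  have "\<exists>u\<in>K. \<forall>g\<in>carrier G. \<epsilon> \<le> D u g"
  proof (rule minimax[OF cK K0])
    show "continuous_on UNIV (\<lambda>u. D u g)" for g
      unfolding D_def by (intro continuous_on_sum continuous_on_diff continuous_on_product_coordinates)
    show "\<exists>w\<in>K. \<forall>g. D w g = (1 - t) * D u g + t * D v g"
      if uv: "u \<in> K" "v \<in> K" and t: "0 \<le> t" "t \<le> 1" for u v t
    proof (intro bexI allI)
      show "D (\<lambda>i. (1 - t) * u i + t * v i) g = (1 - t) * D u g + t * D v g" for g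
        unfolding D_def sum_distrib_left sum.distrib[symmetric]
        by (rule sum.cong) (auto simp: algebra_simps)
      have "\<bar>(1 - t) * u i + t * v i\<bar> \<le> 1" for i
      proof -
        have "\<bar>(1 - t) * u i + t * v i\<bar> \<le> (1 - t) * \<bar>u i\<bar> + t * \<bar>v i\<bar>"
          using t abs_triangle_ineq[of "(1 - t) * u i" "t * v i"] by (simp add: abs_mult)
        also have "\<dots> \<le> (1 - t) * 1 + t * 1"
          using t uv by (intro add_mono mult_left_mono) (simp_all add: Kiff del: split_paired_All)
        finally show ?thesis by simp
      qed
      then show "(\<lambda>i. (1 - t) * u i + t * v i) \<in> K" by (simp add: Kiff)
    qed
    fix p :: "'a \<Rightarrow> real" and A
    assume A: "finite A" "A \<subseteq> carrier G" and p: "\<And>g. 0 \<le> p g" "\<And>g. g \<notin> A \<Longrightarrow> p g = 0"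
    have fN: "finite (N A)" "A \<subseteq> N A" "N A \<subseteq> carrier G" using A S by (auto simp: N_def)
    \<comment> \<open>The point of the cube at which the pairing with \<open>p\<close> attains the total variation.\<close>
    define v where "v = (\<lambda>(s, g). sgn (p (s \<otimes> g) - p g))"
    have "(\<Sum>g\<in>A. p g * v (s, inv s \<otimes> g)) = (\<Sum>g\<in>N A. p (s \<otimes> g) * v (s, g))" if s: "s \<in> S" for s
    proof -
      have sc: "s \<in> carrier G" using s S by auto
      have "(\<Sum>g\<in>A. p g * v (s, inv s \<otimes> g)) = (\<Sum>g\<in>(\<lambda>g. inv s \<otimes> g) ` A. p (s \<otimes> g) * v (s, g))"
        by (subst sum.reindex)
           (use A sc in \<open>auto simp: inj_on_def m_assoc[symmetric] subset_iff intro!: sum.cong\<close>)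
      also have "\<dots> = (\<Sum>g\<in>N A. p (s \<otimes> g) * v (s, g))"
      proof (rule sum.mono_neutral_left)
        show "\<forall>g\<in>N A - (\<lambda>g. inv s \<otimes> g) ` A. p (s \<otimes> g) * v (s, g) = 0"
        proof
          fix g assume g: "g \<in> N A - (\<lambda>g. inv s \<otimes> g) ` A"
          then have "g = inv s \<otimes> (s \<otimes> g)" using fN(3) sc by (auto simp: m_assoc[symmetric])
          then have "s \<otimes> g \<notin> A" using g by blast
          then show "p (s \<otimes> g) * v (s, g) = 0" using p(2) by simp
        qed
      qed (use fN s in \<open>auto simp: N_def\<close>)
      finally show ?thesis .
    qed
    moreover have "(\<Sum>g\<in>A. p g * v (s, g)) = (\<Sum>g\<in>N A. p g * v (s, g))" for s
      by (rule sum.mono_neutral_left) (use fN p in auto)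
    ultimately have "(\<Sum>g\<in>A. p g * D v g) = (\<Sum>s\<in>S. \<Sum>g\<in>N A. (p (s \<otimes> g) - p g) * v (s, g))"
      by (simp add: D_def sum_distrib_left right_diff_distrib left_diff_distrib sum_subtractf sum.swap[of _ _ A])
    also have "\<dots> = (\<Sum>s\<in>S. \<Sum>g\<in>N A. \<bar>p (s \<otimes> g) - p g\<bar>)"
      by (simp add: v_def abs_sgn)
    finally have "\<epsilon> * sum p A \<le> (\<Sum>g\<in>A. p g * D v g)" using expand[OF A p] by simp
    moreover have "v \<in> K" by (auto simp: Kiff v_def sgn_if)
    ultimately show "\<exists>v\<in>K. \<epsilon> * sum p A \<le> (\<Sum>g\<in>A. p g * D v g)" by blast
  qed
  then obtain u where u: "u \<in> K" "\<And>g. g \<in> carrier G \<Longrightarrow> \<epsilon> \<le> D u g" by blast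
  obtain m where m: "left_invariant_mean G m" using am by (auto simp: amenable_def)
  have Du: "D u \<in> bounded_funs G" "m (D u) = 0"
    using mean_of_divergence[OF m S, of "\<lambda>s g. u (s, g)" 1] u(1) by (auto simp: D_def[abs_def] Kiff)
  note m' = m[unfolded left_invariant_mean_def]
  have one: "(\<lambda>x. 1) \<in> bounded_funs G" and c: "(\<lambda>x. - \<epsilon> * 1) \<in> bounded_funs G"
    using \<epsilon> by (auto simp: bounded_funs_def bounded_iff intro!: exI[of _ "max 1 \<epsilon>"])
  have add: "m (\<lambda>x. f x + g x) = m f + m g" if "f \<in> bounded_funs G" "g \<in> bounded_funs G" for f g
    using m' that by blast
  have scale: "m (\<lambda>x. t * f x) = t * m f" if "f \<in> bounded_funs G" for t f using m' that by blast
  have pos: "0 \<le> m f" if "f \<in> bounded_funs G" "\<And>x. x \<in> carrier G \<Longrightarrow> 0 \<le> f x" for f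
    using m' that by blast
  have "m (\<lambda>x. D u x + - \<epsilon> * 1) = m (D u) + m (\<lambda>x. - \<epsilon> * 1)" by (rule add[OF Du(1) c])
  also have "m (\<lambda>x. - \<epsilon> * 1) = - \<epsilon> * m (\<lambda>x. 1)" by (rule scale[OF one])
  also have "m (\<lambda>x. 1) = 1" using m' by blast
  finally have "m (\<lambda>x. D u x + - \<epsilon> * 1) < 0" using Du(2) \<epsilon> by simp
  moreover have "(\<lambda>x. D u x + - \<epsilon> * 1) \<in> bounded_funs G"
  proof -
    obtain C where "\<And>x. x \<in> carrier G \<Longrightarrow> \<bar>D u x\<bar> \<le> C"
      using Du(1) by (auto simp: bounded_funs_def bounded_iff)
    then have "\<bar>D u x + - \<epsilon> * 1\<bar> \<le> C + \<epsilon>" if "x \<in> carrier G" for x using that \<epsilon> by (smt (verit))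
    then show ?thesis unfolding bounded_funs_def bounded_iff by auto
  qed
  then have "0 \<le> m (\<lambda>x. D u x + - \<epsilon> * 1)" by (rule pos) (use u(2) in simp)
  ultimately show False by simp
qed

section \<open>Approximate eigenfunctions on finite orbits\<close>

lemma sqrt_diff_power2_le:
  fixes x y :: real
  assumes "0 \<le> x" "0 \<le> y" shows "(sqrt x - sqrt y)\<^sup>2 \<le> \<bar>x - y\<bar>"
proof -
  have "(sqrt x - sqrt y)\<^sup>2 = \<bar>sqrt x - sqrt y\<bar> * \<bar>sqrt x - sqrt y\<bar>"
    by (simp add: power2_eq_square)
  also have "\<dots> \<le> \<bar>sqrt x - sqrt y\<bar> * (sqrt x + sqrt y)"
    using assms by (intro mult_left_mono) (auto simp: abs_le_iff)
  also have "\<dots> = \<bar>(sqrt x - sqrt y) * (sqrt x + sqrt y)\<bar>"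
    using assms by (simp add: abs_mult)
  also have "(sqrt x - sqrt y) * (sqrt x + sqrt y) = x - y"
    using assms by (simp add: algebra_simps)
  finally show ?thesis .
qed

lemma cmod_average_power2_le:
  assumes "finite S" "S \<noteq> {}"
  shows "(cmod (1 / of_nat (card S) * (\<Sum>s\<in>S. c s)))\<^sup>2 \<le> 1 / real (card S) * (\<Sum>s\<in>S. (cmod (c s))\<^sup>2)"
proof -
  have n: "0 < real (card S)" using assms by (simp add: card_gt_0_iff)
  have "(cmod (\<Sum>s\<in>S. c s))\<^sup>2 \<le> (\<Sum>s\<in>S. cmod (c s))\<^sup>2"
    by (intro power_mono norm_sum) auto
  also have "\<dots> \<le> (\<Sum>s\<in>S. (cmod (c s))\<^sup>2) * real (card S)"
    by (rule sum_squared_le_sum_of_squares)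
  finally show ?thesis
    using n by (simp add: norm_mult norm_divide power_divide field_simps power2_eq_square)
qed

text \<open>
  Approximate eigenfunctions on finite sets with a \<open>G\<close>-action push the point into the spectrum on
  \<open>l\<^sup>2(G)\<close>. A bounded inverse of \<open>T - z\<close> would give \<open>\<parallel>h\<parallel>\<^sup>2 \<le> K \<parallel>(T - z)h\<parallel>\<^sup>2\<close>. Test this on
  \<open>h\<^sub>x(g) = f(gx) \<surd>p(g)\<close> with an almost invariant density \<open>p\<close> and add over \<open>x\<close>: since each \<open>g\<close>
  permutes \<open>V\<close>, the left sides add up to \<open>\<parallel>f\<parallel>\<^sup>2\<close>, while the right sides are controlled by the
  variation of \<open>p\<close> and the error of \<open>f\<close>.
\<close>

lemma (in group) approximate_eigenfunctions_imp_spectrum: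
  fixes act :: "'a \<Rightarrow> 'x \<Rightarrow> 'x"
  assumes am: "amenable G" and S: "finite S" "S \<noteq> {}" "S \<subseteq> carrier G"
    and act: "\<And>g h x. g \<in> carrier G \<Longrightarrow> h \<in> carrier G \<Longrightarrow> act (g \<otimes> h) x = act g (act h x)"
    and approx: "\<And>\<eta>. 0 < \<eta> \<Longrightarrow> \<exists>V f. finite V \<and> (\<forall>g\<in>carrier G. bij_betw (act g) V V) \<and>
      0 < (\<Sum>x\<in>V. (cmod (f x))\<^sup>2) \<and>
      (\<Sum>x\<in>V. (cmod (1 / of_nat (card S) * (\<Sum>s\<in>S. f (act (inv s) x)) - z * f x))\<^sup>2)
        \<le> \<eta> * (\<Sum>x\<in>V. (cmod (f x))\<^sup>2)"
  shows "z \<in> sp G S"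
proof (rule ccontr)
  assume "z \<notin> sp G S"
  define T where "T = markov_operator G S"
  obtain R where R: "l2_bounded_operator G R"
      "\<And>f. f \<in> l2_space G \<Longrightarrow> R (\<lambda>x. T f x - z * f x) = f"
    using \<open>z \<notin> sp G S\<close> unfolding sp_def l2_spectrum_def T_def by auto
  obtain K where K: "K > 0" "\<And>f. f \<in> l2_space G \<Longrightarrow> l2_sq G (R f) \<le> K * l2_sq G f"
    using l2_bounded_operatorD(5)[OF R(1)] by auto
  define n where "n = real (card S)"
  have n: "0 < n" using S by (simp add: n_def card_gt_0_iff)
  have K8: "0 < 1 / (8 * K)" "0 < n / (8 * K)" using K(1) n by auto
  obtain V f where V: "finite V" "\<And>g. g \<in> carrier G \<Longrightarrow> bij_betw (act g) V V"
      "0 < (\<Sum>x\<in>V. (cmod (f x))\<^sup>2)"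
      "(\<Sum>x\<in>V. (cmod (1 / of_nat (card S) * (\<Sum>s\<in>S. f (act (inv s) x)) - z * f x))\<^sup>2)
        \<le> 1 / (8 * K) * (\<Sum>x\<in>V. (cmod (f x))\<^sup>2)"
    using approx[OF K8(1)] by auto
  define F where "F = (\<Sum>x\<in>V. (cmod (f x))\<^sup>2)"
  define e where "e x = 1 / of_nat (card S) * (\<Sum>s\<in>S. f (act (inv s) x)) - z * f x" for x
  define E where "E = (\<Sum>x\<in>V. (cmod (e x))\<^sup>2)"
  have inv_S: "finite (m_inv G ` S)" "m_inv G ` S \<subseteq> carrier G" using S by auto
  obtain p B where p: "\<And>g. (0::real) \<le> p g" "sum p B = 1" "\<And>g. g \<notin> B \<Longrightarrow> p g = 0"
      and B: "finite B" "B \<subseteq> carrier G"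
      and pB: "\<And>s g. s \<in> m_inv G ` S \<Longrightarrow> g \<in> carrier G \<Longrightarrow> g \<notin> B \<Longrightarrow> p (s \<otimes> g) = 0"
      and small': "(\<Sum>s\<in>m_inv G ` S. \<Sum>g\<in>B. \<bar>p (s \<otimes> g) - p g\<bar>) \<le> n / (8 * K)"
    by (rule amenable_imp_reiter[OF am inv_S K8(2)]) blast
  have small: "(\<Sum>s\<in>S. \<Sum>g\<in>B. \<bar>p (inv s \<otimes> g) - p g\<bar>) \<le> n / (8 * K)"
  proof -
    have "inj_on (m_inv G) S" using inj_on_subset[OF inv_inj S(3)] .
    from sum.reindex[OF this, of "\<lambda>s. \<Sum>g\<in>B. \<bar>p (s \<otimes> g) - p g\<bar>"] small'
    show ?thesis by (simp only: comp_def)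
  qed
  define h where "h x g = f (act g x) * of_real (sqrt (p g))" for x g
  have h_off: "h x g = 0" if "g \<notin> B" for x g using p(3)[OF that] by (simp add: h_def)
  have hL: "h x \<in> l2_space G" and h_sq: "l2_sq G (h x) = (\<Sum>g\<in>B. (cmod (h x g))\<^sup>2)" for x
    using l2_finite_support[OF B h_off] by auto
  define D where "D x g = T (h x) g - z * h x g" for x g
  have D_off: "D x g = 0" if "g \<notin> B" for x g
  proof -
    have "T (h x) g = 0"
      using pB[of _ g] that by (auto simp: T_def markov_operator_def h_def intro!: sum.neutral)
    then show ?thesis using h_off[OF that] by (simp add: D_def)
  qed
  have DL: "D x \<in> l2_space G" and D_sq: "l2_sq G (D x) = (\<Sum>g\<in>B. (cmod (D x g))\<^sup>2)" for x
    using l2_finite_support[OF B D_off] by auto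
  have hD: "l2_sq G (h x) \<le> K * l2_sq G (D x)" for x
    using K(2)[OF DL, of x] R(2)[OF hL, of x] by (simp add: D_def[abs_def])
  have orbit: "(\<Sum>x\<in>V. (cmod (k (act g x)))\<^sup>2) = (\<Sum>x\<in>V. (cmod (k x))\<^sup>2)" if "g \<in> carrier G" for g k
    using sum.reindex_bij_betw[OF V(2)[OF that], of "\<lambda>x. (cmod (k x))\<^sup>2"] .
  have total: "(\<Sum>x\<in>V. l2_sq G (h x)) = F"
  proof -
    have "(\<Sum>x\<in>V. l2_sq G (h x)) = (\<Sum>x\<in>V. \<Sum>g\<in>B. p g * (cmod (f (act g x)))\<^sup>2)"
      unfolding h_sq by (simp add: h_def norm_mult power_mult_distrib p(1) mult.commute)
    also have "\<dots> = (\<Sum>g\<in>B. p g * (\<Sum>x\<in>V. (cmod (f (act g x)))\<^sup>2))"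
      by (simp add: sum.swap[of _ V] sum_distrib_left)
    also have "\<dots> = (\<Sum>g\<in>B. p g * F)"
      using B by (intro sum.cong) (auto simp: orbit F_def)
    finally show ?thesis using p(2) by (simp flip: sum_distrib_right)
  qed
  \<comment> \<open>The error splits into the variation of the square root of \<open>p\<close>, weighted by \<open>f\<close>, and the error of \<open>f\<close>,
    weighted by the square root of \<open>p\<close>.\<close>
  have local: "(cmod (D x g))\<^sup>2 \<le>
      2 * (1 / n * (\<Sum>s\<in>S. (cmod (f (act (inv s \<otimes> g) x)))\<^sup>2 * \<bar>p (inv s \<otimes> g) - p g\<bar>))
      + 2 * (p g * (cmod (e (act g x)))\<^sup>2)" if g: "g \<in> B" for x g
  proof -
    have gc: "g \<in> carrier G" using g B by auto
    define c where "c s = f (act (inv s \<otimes> g) x) * of_real (sqrt (p (inv s \<otimes> g)) - sqrt (p g))" for s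
    have "D x g = 1 / of_nat (card S) * (\<Sum>s\<in>S. c s) + of_real (sqrt (p g)) * e (act g x)"
    proof -
      have "f (act (inv s) (act g x)) = f (act (inv s \<otimes> g) x)" if "s \<in> S" for s
        using act[of "inv s" g x] that S gc by auto
      then have ex: "e (act g x) = 1 / of_nat (card S) * (\<Sum>s\<in>S. f (act (inv s \<otimes> g) x)) - z * f (act g x)"
        unfolding e_def by simp
      have C: "(\<Sum>s\<in>S. c s) = (\<Sum>s\<in>S. h x (inv s \<otimes> g))
          - (\<Sum>s\<in>S. f (act (inv s \<otimes> g) x)) * of_real (sqrt (p g))"
        unfolding c_def h_def by (simp add: right_diff_distrib sum_subtractf sum_distrib_right)
      have Dx: "D x g = 1 / of_nat (card S) * (\<Sum>s\<in>S. h x (inv s \<otimes> g))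
          - z * (f (act g x) * of_real (sqrt (p g)))"
        using gc by (simp add: D_def T_def markov_operator_def) (simp add: h_def)
      show ?thesis unfolding Dx C ex by (simp add: algebra_simps diff_divide_distrib)
    qed
    then have "(cmod (D x g))\<^sup>2 \<le> 2 * (cmod (1 / of_nat (card S) * (\<Sum>s\<in>S. c s)))\<^sup>2
        + 2 * (cmod (of_real (sqrt (p g)) * e (act g x)))\<^sup>2"
      using cmod_add_power2_le by simp
    also have "\<dots> \<le> 2 * (1 / n * (\<Sum>s\<in>S. (cmod (c s))\<^sup>2)) + 2 * (p g * (cmod (e (act g x)))\<^sup>2)"
      using cmod_average_power2_le[OF S(1,2), of c]
      by (simp add: n_def norm_mult power_mult_distrib p(1))
    also have "(\<Sum>s\<in>S. (cmod (c s))\<^sup>2)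
        \<le> (\<Sum>s\<in>S. (cmod (f (act (inv s \<otimes> g) x)))\<^sup>2 * \<bar>p (inv s \<otimes> g) - p g\<bar>)"
    proof (rule sum_mono)
      fix s
      have "(cmod (c s))\<^sup>2 = (cmod (f (act (inv s \<otimes> g) x)))\<^sup>2 * (sqrt (p (inv s \<otimes> g)) - sqrt (p g))\<^sup>2"
        unfolding c_def norm_mult norm_of_real power_mult_distrib power2_abs ..
      then show "(cmod (c s))\<^sup>2 \<le> (cmod (f (act (inv s \<otimes> g) x)))\<^sup>2 * \<bar>p (inv s \<otimes> g) - p g\<bar>"
        by (simp add: mult_left_mono sqrt_diff_power2_le p(1))
    qed
    finally show ?thesis using n by (simp add: divide_right_mono)
  qed
  have "(\<Sum>x\<in>V. l2_sq G (D x)) \<le> (\<Sum>x\<in>V. \<Sum>g\<in>B.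
      2 * (1 / n * (\<Sum>s\<in>S. (cmod (f (act (inv s \<otimes> g) x)))\<^sup>2 * \<bar>p (inv s \<otimes> g) - p g\<bar>))
      + 2 * (p g * (cmod (e (act g x)))\<^sup>2))"
    unfolding D_sq by (intro sum_mono local)
  also have "\<dots> = (\<Sum>g\<in>B.
      2 * (1 / n * (\<Sum>s\<in>S. (\<Sum>x\<in>V. (cmod (f (act (inv s \<otimes> g) x)))\<^sup>2) * \<bar>p (inv s \<otimes> g) - p g\<bar>))
      + 2 * (p g * (\<Sum>x\<in>V. (cmod (e (act g x)))\<^sup>2)))"
    by (simp add: sum.swap[of _ V] sum.distrib sum_distrib_left sum_distrib_right)
  also have "\<dots> = (\<Sum>g\<in>B. 2 * (1 / n * (\<Sum>s\<in>S. F * \<bar>p (inv s \<otimes> g) - p g\<bar>))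
      + 2 * (p g * E))"
  proof (rule sum.cong[OF refl])
    fix g assume "g \<in> B"
    then have g: "g \<in> carrier G" using B by auto
    have "(\<Sum>x\<in>V. (cmod (f (act (inv s \<otimes> g) x)))\<^sup>2) = F" if "s \<in> S" for s
      unfolding F_def using orbit[of "inv s \<otimes> g" f] that S g by auto
    then show "2 * (1 / n * (\<Sum>s\<in>S. (\<Sum>x\<in>V. (cmod (f (act (inv s \<otimes> g) x)))\<^sup>2) * \<bar>p (inv s \<otimes> g) - p g\<bar>))
      + 2 * (p g * (\<Sum>x\<in>V. (cmod (e (act g x)))\<^sup>2))
      = 2 * (1 / n * (\<Sum>s\<in>S. F * \<bar>p (inv s \<otimes> g) - p g\<bar>)) + 2 * (p g * E)"
      using orbit[OF g, of e] by (simp add: E_def)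
  qed
  also have "\<dots> = 2 / n * F * (\<Sum>s\<in>S. \<Sum>g\<in>B. \<bar>p (inv s \<otimes> g) - p g\<bar>) + 2 * sum p B * E"
    by (simp add: sum.distrib sum.swap[of _ S] sum_distrib_left sum_distrib_right mult.assoc)
  \<comment> \<open>The tolerances \<open>n / (8K)\<close> for \<open>p\<close> and \<open>1 / (8K)\<close> for \<open>f\<close> were chosen to make the total at most half
    of the contradictory value \<open>F / K\<close>.\<close>
  also have "\<dots> \<le> 2 / n * F * (n / (8 * K)) + 2 * 1 * (1 / (8 * K) * F)"
    using V(3,4) n p(2) small unfolding F_def E_def e_def by (intro add_mono mult_left_mono) auto
  also have "\<dots> = F / (2 * K)" using n K(1) by (simp add: field_simps)
  finally have "K * (\<Sum>x\<in>V. l2_sq G (D x)) \<le> F / 2"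
    using K(1) by (simp add: field_simps)
  moreover have "F \<le> K * (\<Sum>x\<in>V. l2_sq G (D x))"
    unfolding total[symmetric] sum_distrib_left by (intro sum_mono hD)
  ultimately show False using V(3) unfolding F_def by linarith
qed

section \<open>The levels of the tree as paths\<close>

text \<open>
  The position of a word along the path formed by its level, counted from \<open>11\<dots>1\<close> (a reflected Gray
  code): position \<open>J\<close> of the tail becomes the pair \<open>2J, 2J + 1\<close>, joined by \<open>a\<close>, and the pairs are
  oriented alternately so that the word \<open>0v\<close> of each pair faces the word \<open>0v'\<close> of a neighbouring
  pair. The values are integers so that stepping down needs no case distinction at 0.
\<close>

fun path_pos :: "vertex \<Rightarrow> int" where
  "path_pos [] = 0"
| "path_pos (x # v) = 2 * path_pos v + (if x = even (path_pos v) then 0 else 1)"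

text \<open>
  These are the words moved by some \<open>\<sigma>\<^sub>k\<close> with \<open>k \<ge> 1\<close>; the remaining words of each level are the ends of
  the path, fixed by \<open>b\<close>, \<open>c\<close> and \<open>d\<close>.
\<close>

definition inner_vertex :: "vertex \<Rightarrow> bool" where
  "inner_vertex v \<longleftrightarrow> (\<exists>k x t. v = w_word (Suc k) @ x # t)"

lemma gen_a_Cons: "gen_a (x # v) = (\<not> x) # v"
  using sigma_w[of 0 v] by (cases x) (simp_all add: gen_a_def)

lemma length_gens [simp]:
  "length (gen_a v) = length v" "length (gen_b \<omega> v) = length v"
  "length (gen_c \<omega> v) = length v" "length (gen_d \<omega> v) = length v"
  by (simp_all add: gen_a_def gen_b_def gen_c_def gen_d_def sigma_prod_def)

lemma path_pos_gen_a:
  assumes "v \<noteq> []"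
  shows "path_pos (gen_a v) = path_pos v + (if even (path_pos v) then 1 else -1)"
  using assms by (cases v) (auto simp: gen_a_Cons)

text \<open>
  Induction on the length of the prefix: in the base case the tails form an \<open>a\<close>-edge and the leading
  0 selects the facing ends of the two pairs; each further leading 1 selects the facing ends of the
  pairs belonging to an edge of the same kind one level below.
\<close>

lemma path_pos_flip:
  "path_pos (w_word (Suc k) @ (\<not> x) # t) =
     path_pos (w_word (Suc k) @ x # t) + (if odd (path_pos (w_word (Suc k) @ x # t)) then 1 else -1)"
proof (induction k)
  case 0
  then show ?case by auto
next
  case (Suc k)
  have "w_word (Suc (Suc k)) = True # w_word (Suc k)" by simp
  then show ?case using Suc by (auto simp del: w_word.simps)
qed

text \<open>
  The words \<open>w\<^sub>n\<close> with \<open>n \<ge> 1\<close> are pairwise incomparable prefixes, so a single factor acts.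
\<close>

lemma sigma_prod_inner:
  assumes "0 \<notin> A"
  shows "sigma_prod A (w_word (Suc k) @ x # t) = w_word (Suc k) @ (if Suc k \<in> A then \<not> x else x) # t"
proof -
  have flip: "sigma (Suc k) (w_word (Suc k) @ y # t) = w_word (Suc k) @ (\<not> y) # t" for y
    using sigma_w[of "Suc k" t] by (cases y) simp_all
  have other: "sigma n (w_word (Suc k) @ y # t) = w_word (Suc k) @ y # t" if "0 < n" "n \<noteq> Suc k" for n y
  proof -
    have "\<not> prefix (w_word n) (w_word (Suc k) @ y # t)"
      using w_incomparable[of n "Suc k"] w_incomparable[of "Suc k" n] that
      by (metis linorder_neqE_nat prefixI zero_less_Suc)
    then show ?thesis by (simp add: sigma_def strict_prefix_def)
  qed
  have "sigma_partial_prod A N (w_word (Suc k) @ x # t) =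
      w_word (Suc k) @ (if Suc k \<in> A \<and> Suc k < N then \<not> x else x) # t" for N
  proof (induction N)
    case 0
    then show ?case by (simp add: sigma_partial_prod_def)
  next
    case (Suc N)
    show ?case
    proof (cases "N \<in> A")
      case True
      then have "0 < N" using assms by (cases N) auto
      show ?thesis
        using True Suc.IH other[OF \<open>0 < N\<close>] flip
        by (cases "N = Suc k") (auto simp: sigma_partial_prod_Suc less_Suc_eq simp del: w_word.simps)
    next
      case False
      then show ?thesis using Suc.IH
        by (auto simp: sigma_partial_prod_Suc less_Suc_eq simp del: w_word.simps)
    qed
  qed
  then show ?thesis by (simp add: sigma_prod_def del: w_word.simps)
qed

lemma sigma_prod_end:
  assumes "0 \<notin> A" "\<not> inner_vertex v" shows "sigma_prod A v = v"
proof -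
  have "sigma n v = v" if "0 < n" for n
  proof (rule sigma_other)
    fix x t
    obtain k where "n = Suc k" using \<open>0 < n\<close> by (cases n) auto
    then show "v \<noteq> w_word n @ x # t" using assms(2) unfolding inner_vertex_def by blast
  qed
  then have "N \<in> A \<Longrightarrow> sigma N v = v" for N
    using assms(1) by (cases "N = 0") auto
  then have "sigma_partial_prod A N v = v" for N
    by (induction N) (simp_all add: sigma_partial_prod_Suc, simp add: sigma_partial_prod_def)
  then show ?thesis by (simp add: sigma_prod_def)
qed

lemma end_vertices:
  assumes "\<not> inner_vertex v"
  shows "v = replicate (length v) True \<or> v = replicate (length v - 1) True @ [False]"
  using assms
proof (induction v)
  case (Cons y v)
  show ?case
  proof (cases y)
    case True
    have "\<not> inner_vertex v"
    proof
      assume "inner_vertex v"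
      then obtain k x t where "v = w_word (Suc k) @ x # t" unfolding inner_vertex_def by blast
      then have "y # v = w_word (Suc (Suc k)) @ x # t" using True by simp
      then show False using Cons.prems unfolding inner_vertex_def by blast
    qed
    from Cons.IH[OF this] show ?thesis
    proof
      assume "v = replicate (length v) True"
      then show ?thesis using True by (metis length_Cons replicate_Suc)
    next
      assume v: "v = replicate (length v - 1) True @ [False]"
      then have "0 < length v" by (cases v) auto
      then have "y # v = replicate (length (y # v) - 1) True @ [False]"
        using v True by (cases "length v") auto
      then show ?thesis by blast
    qed
  next
    case False
    have "v = []"
    proof (rule ccontr)
      assume "v \<noteq> []"
      then obtain x t where "v = x # t" by (cases v) auto
      then have "y # v = w_word (Suc 0) @ x # t" using False by simp
      then show False using Cons.prems unfolding inner_vertex_def by blast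
    qed
    then show ?thesis using False by simp
  qed
qed simp

lemma card_end_vertices: "card {v. length v = n \<and> \<not> inner_vertex v} \<le> 2"
proof -
  have "card {v. length v = n \<and> \<not> inner_vertex v} \<le> card {replicate n True, replicate (n - 1) True @ [False]}"
    by (rule card_mono) (use end_vertices in auto)
  also have "\<dots> \<le> 2" by (simp add: card_insert_if)
  finally show ?thesis .
qed

lemma zero_notin_Pi_indices: "0 \<notin> Pi_indices \<omega> r"
  by (simp add: Pi_indices_def)

text \<open>
  Exactly two of \<open>b, c, d\<close> move an inner vertex, both to the same neighbour, whatever the letter of
  \<open>\<omega>\<close> is.
\<close>

lemma sum_bcd_inner:
  assumes "inner_vertex v"
  obtains u where "path_pos u = path_pos v + (if odd (path_pos v) then 1 else -1)"
    "\<And>f. f (gen_b \<omega> v) + f (gen_c \<omega> v) + f (gen_d \<omega> v) = f v + 2 * (f u :: complex)"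
proof -
  obtain k x t where v: "v = w_word (Suc k) @ x # t" using assms unfolding inner_vertex_def by blast
  define u where "u = w_word (Suc k) @ (\<not> x) # t"
  have g: "sigma_prod (Pi_indices \<omega> r) v = (if column (\<omega> (Suc k)) ! r = Letter_Pi then u else v)" for r
    unfolding v u_def sigma_prod_inner[OF zero_notin_Pi_indices] by (simp add: Pi_indices_def)
  show ?thesis
  proof (rule that[of u])
    show "path_pos u = path_pos v + (if odd (path_pos v) then 1 else -1)"
      unfolding u_def v by (rule path_pos_flip)
    show "f (gen_b \<omega> v) + f (gen_c \<omega> v) + f (gen_d \<omega> v) = f v + 2 * (f u :: complex)" for f
      unfolding gen_b_def gen_c_def gen_d_def g by (cases "\<omega> (Suc k)") simp_all
  qed
qed

text \<open>
  With \<open>\<mu> = 4r - 1\<close>, the equation reads \<open>f(av) + 2f(uv) = \<mu>f(v)\<close>, where \<open>uv\<close> is the neighbour of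
  \<open>v\<close> across its double edge. The ansatz \<open>e\<^bsup>i\<theta>j\<^esup>\<close> at position \<open>2j\<close> and \<open>\<beta>e\<^bsup>i\<theta>j\<^esup>\<close> at
  \<open>2j + 1\<close> leads to \<open>\<beta>(1 + 2e\<^bsup>-i\<theta>\<^esup>) = \<mu>\<close> and \<open>1 + 2e\<^bsup>i\<theta>\<^esup> = \<mu>\<beta>\<close>, which are compatible
  with \<open>|\<beta>| = 1\<close> precisely when \<open>\<mu>\<^sup>2 = |1 + 2e\<^bsup>i\<theta>\<^esup>|\<^sup>2 = 5 + 4 cos \<theta>\<close>.
\<close>

lemma plane_wave:
  fixes r :: real
  assumes r: "r \<in> {-1/2..0} \<union> {1/2..1}"
  obtains f :: "vertex \<Rightarrow> complex" where "\<And>v. cmod (f v) = 1"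
    "\<And>v. inner_vertex v \<Longrightarrow>
      f (gen_a v) + f (gen_b \<omega> v) + f (gen_c \<omega> v) + f (gen_d \<omega> v) = 4 * of_real r * f v"
proof -
  define \<mu> where "\<mu> = 4 * r - 1"
  have mu: "1 \<le> \<bar>\<mu>\<bar>" "\<bar>\<mu>\<bar> \<le> 3" using r by (auto simp: \<mu>_def)
  have "1 \<le> \<mu>\<^sup>2" "\<mu>\<^sup>2 \<le> 9"
    using power_mono[OF mu(1), of 2] power_mono[OF mu(2), of 2] by simp_all
  then have C: "-1 \<le> (\<mu>\<^sup>2 - 5) / 4" "(\<mu>\<^sup>2 - 5) / 4 \<le> 1" by auto
  define \<theta> where "\<theta> = arccos ((\<mu>\<^sup>2 - 5) / 4)"
  have "cos \<theta> = (\<mu>\<^sup>2 - 5) / 4" unfolding \<theta>_def by (rule cos_arccos[OF C])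
  then have cos: "\<mu>\<^sup>2 = 5 + 4 * cos \<theta>" by (simp add: field_simps)
  define d where "d = 1 + 2 * cis \<theta>"
  have dd: "d * cnj d = of_real (\<mu>\<^sup>2)"
  proof -
    have square: "(1 + 2 * x)\<^sup>2 + (2 * y)\<^sup>2 = 1 + 4 * x + 4 * (y\<^sup>2 + x\<^sup>2)" for x y :: real
      by (simp add: power2_eq_square algebra_simps)
    have "(cmod d)\<^sup>2 = (1 + 2 * cos \<theta>)\<^sup>2 + (2 * sin \<theta>)\<^sup>2"
      by (simp add: d_def cmod_power2)
    also have "\<dots> = \<mu>\<^sup>2" unfolding square cos by simp
    finally have "(cmod d)\<^sup>2 = \<mu>\<^sup>2" .
    then show ?thesis using complex_norm_square[of d] by simp
  qed
  have d0: "cnj d \<noteq> 0" using dd mu(1) by auto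
  define \<beta> where "\<beta> = of_real \<mu> / cnj d"
  have b1: "\<beta> * cnj d = of_real \<mu>" using d0 by (simp add: \<beta>_def)
  have b2: "d = of_real \<mu> * \<beta>" using dd d0 by (simp add: \<beta>_def field_simps power2_eq_square)
  have "cmod d = \<bar>\<mu>\<bar>"
  proof -
    have "(cmod d)\<^sup>2 = \<mu>\<^sup>2"
      using dd complex_norm_square[of d] by (simp flip: of_real_power)
    then show ?thesis by (smt (verit) power2_eq_iff norm_ge_zero)
  qed
  then have b3: "cmod \<beta> = 1" using mu(1) by (simp add: \<beta>_def norm_divide)
  define f where "f v = cis (\<theta> * of_int (path_pos v div 2)) * (if even (path_pos v) then 1 else \<beta>)" for v
  show ?thesis
  proof (rule that[of f])
    show "cmod (f v) = 1" for v by (simp add: f_def norm_mult b3)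
    fix v assume v: "inner_vertex v"
    then have "v \<noteq> []" by (auto simp: inner_vertex_def)
    obtain u where pu: "path_pos u = path_pos v + (if odd (path_pos v) then 1 else -1)"
        and su: "f (gen_b \<omega> v) + f (gen_c \<omega> v) + f (gen_d \<omega> v) = f v + 2 * f u"
      using sum_bcd_inner[OF v, of \<omega>] by metis
    note pa = path_pos_gen_a[OF \<open>v \<noteq> []\<close>]
    have "f (gen_a v) + 2 * f u = of_real \<mu> * f v"
    proof (cases "even (path_pos v)")
      case True
      then obtain i where i: "path_pos v = 2 * i" by auto
      have fv: "f v = cis (\<theta> * of_int i)" using i by (simp add: f_def)
      have fa: "f (gen_a v) = cis (\<theta> * of_int i) * \<beta>"
        using i pa by (simp add: f_def)
      have "(2 * i - 1) div 2 = i - 1" "odd (2 * i - 1)" by presburger+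
      then have "f u = cis (\<theta> * of_int (i - 1)) * \<beta>"
        using i pu by (simp add: f_def)
      also have "cis (\<theta> * of_int (i - 1)) = cis (\<theta> * of_int i) * cnj (cis \<theta>)"
        by (simp add: cis_mult cis_cnj algebra_simps)
      finally have "f (gen_a v) + 2 * f u = cis (\<theta> * of_int i) * (\<beta> * cnj d)"
        by (simp add: fa d_def algebra_simps)
      then show ?thesis by (simp add: b1 fv)
    next
      case False
      then obtain i where i: "path_pos v = 2 * i + 1" by (elim oddE)
      have fv: "f v = cis (\<theta> * of_int i) * \<beta>" using i by (simp add: f_def)
      have fa: "f (gen_a v) = cis (\<theta> * of_int i)" using i pa by (simp add: f_def)
      have "(2 * i + 2) div 2 = i + 1" by presburger
      then have "f u = cis (\<theta> * of_int (i + 1))" using i pu by (simp add: f_def add.commute)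
      also have "\<dots> = cis (\<theta> * of_int i) * cis \<theta>" by (simp add: cis_mult algebra_simps)
      finally have "f (gen_a v) + 2 * f u = cis (\<theta> * of_int i) * d"
        by (simp add: fa d_def algebra_simps)
      then show ?thesis by (simp add: b2 fv)
    qed
    then show "f (gen_a v) + f (gen_b \<omega> v) + f (gen_c \<omega> v) + f (gen_d \<omega> v) = 4 * of_real r * f v"
      using su by (simp add: \<mu>_def algebra_simps)
  qed
qed

text \<open>
  The error of the plane wave has modulus at most 2 and lives on at most two vertices, so its squared
  norm stays below 8 while that of the wave is \<open>2\<^sup>n\<close>.
\<close>

lemma approximate_eigenfunction_level:
  assumes r: "r \<in> {-1/2..0} \<union> {1/2..1}" and \<eta>: "0 < \<eta>"
  obtains n f where "(\<Sum>v | length v = n. (cmod (f v))\<^sup>2) = 2 ^ n"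
    "(\<Sum>v | length v = n. (cmod (1 / 4 * (f (gen_a v) + f (gen_b \<omega> v) + f (gen_c \<omega> v) + f (gen_d \<omega> v))
        - of_real r * f v))\<^sup>2) \<le> \<eta> * 2 ^ n"
proof -
  obtain f :: "vertex \<Rightarrow> complex" where f: "\<And>v. cmod (f v) = 1"
    and eq: "\<And>v. inner_vertex v \<Longrightarrow>
      f (gen_a v) + f (gen_b \<omega> v) + f (gen_c \<omega> v) + f (gen_d \<omega> v) = 4 * of_real r * f v"
    using plane_wave[OF r, of \<omega>] by blast
  obtain n where n: "8 / \<eta> < 2 ^ n" using real_arch_pow[of 2 "8 / \<eta>"] by auto
  have fin: "finite {v :: vertex. length v = n}"
    using finite_lists_length_eq[of "UNIV :: bool set" n] by simp
  have card: "card {v :: vertex. length v = n} = 2 ^ n"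
    using card_lists_length_eq[of "UNIV :: bool set" n] by simp
  define e where "e v = 1 / 4 * (f (gen_a v) + f (gen_b \<omega> v) + f (gen_c \<omega> v) + f (gen_d \<omega> v)) - of_real r * f v" for v
  have e0: "e v = 0" if "inner_vertex v" for v using eq[OF that] by (simp add: e_def)
  have e2: "(cmod (e v))\<^sup>2 \<le> 4" for v
  proof -
    have "cmod (f (gen_a v) + f (gen_b \<omega> v) + f (gen_c \<omega> v) + f (gen_d \<omega> v)) \<le> 1 + 1 + 1 + 1"
      by (intro norm_triangle_mono) (simp_all add: f)
    then have "cmod (1 / 4 * (f (gen_a v) + f (gen_b \<omega> v) + f (gen_c \<omega> v) + f (gen_d \<omega> v))) \<le> 1"
      by (simp add: norm_mult)
    moreover have "cmod (of_real r * f v) \<le> 1" using r by (auto simp: norm_mult f)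
    ultimately have "cmod (e v) \<le> 1 + 1" unfolding e_def by (intro norm_triangle_le_diff) linarith
    then have "(cmod (e v))\<^sup>2 \<le> 2\<^sup>2" by (intro power_mono) auto
    then show ?thesis by simp
  qed
  have "(\<Sum>v | length v = n. (cmod (e v))\<^sup>2) = (\<Sum>v | length v = n \<and> \<not> inner_vertex v. (cmod (e v))\<^sup>2)"
    by (rule sum.mono_neutral_right) (use fin e0 in auto)
  also have "\<dots> \<le> real (card {v. length v = n \<and> \<not> inner_vertex v}) * 4"
    by (rule sum_bounded_above) (rule e2)
  also have "\<dots> \<le> 2 * 4" using card_end_vertices[of n] by simp
  also have "\<dots> \<le> \<eta> * 2 ^ n" using n \<eta> by (simp add: field_simps)
  finally have "(\<Sum>v | length v = n. (cmod (e v))\<^sup>2) \<le> \<eta> * 2 ^ n" .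
  moreover have "(\<Sum>v | length v = n. (cmod (f v))\<^sup>2) = 2 ^ n" using card by (simp add: f)
  ultimately show ?thesis using that unfolding e_def by blast
qed

section \<open>Groups generated by a four-group and an involution\<close>

text \<open>
  The matrix of \<open>U\<close> on an orbit of the four-group: half of the all-ones matrix minus the identity, a
  reflection up to sign.
\<close>

lemma klein_orbit_isometry:
  "(cmod (y + z + w - x))\<^sup>2 + (cmod (x + w + z - y))\<^sup>2 + (cmod (w + x + y - z))\<^sup>2 + (cmod (z + y + x - w))\<^sup>2
   = 4 * ((cmod x)\<^sup>2 + (cmod y)\<^sup>2 + (cmod z)\<^sup>2 + (cmod w)\<^sup>2)"
  unfolding cmod_power2 by (simp add: power2_eq_square algebra_simps)

lemma l2_sq_sum4:
  assumes "f1 \<in> l2_space G" "f2 \<in> l2_space G" "f3 \<in> l2_space G" "f4 \<in> l2_space G"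
  shows "l2_sq G f1 + l2_sq G f2 + l2_sq G f3 + l2_sq G f4 =
    (\<Sum>\<^sub>\<infinity>x\<in>carrier G. (cmod (f1 x))\<^sup>2 + (cmod (f2 x))\<^sup>2 + (cmod (f3 x))\<^sup>2 + (cmod (f4 x))\<^sup>2)"
  using assms unfolding l2_space_def l2_sq_def by (simp add: infsum_add summable_on_add)

locale klein_four_plus_involution = group G for G (structure) +
  fixes a b c d :: 'a
  assumes gens: "{a, b, c, d} \<subseteq> carrier G"
    and sq: "a \<otimes> a = \<one>" "b \<otimes> b = \<one>" "c \<otimes> c = \<one>" "d \<otimes> d = \<one>"
    and bcd: "b \<otimes> c \<otimes> d = \<one>"
    and card4: "card {a, b, c, d} = 4"
begin

lemma closed [simp]: "a \<in> carrier G" "b \<in> carrier G" "c \<in> carrier G" "d \<in> carrier G"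
  using gens by auto

lemma inv_gens [simp]: "inv a = a" "inv b = b" "inv c = c" "inv d = d"
  using sq by (simp_all add: inv_equality)

lemma klein_table:
  "b \<otimes> c = d" "c \<otimes> b = d" "b \<otimes> d = c" "d \<otimes> b = c" "c \<otimes> d = b" "d \<otimes> c = b"
proof -
  have bc: "b \<otimes> c = d" using bcd sq(4) by (metis closed(2,3,4) m_closed inv_equality inv_gens(4))
  have cb: "c \<otimes> b = d" using inv_mult_group[of b c] bc by simp
  show "b \<otimes> c = d" "c \<otimes> b = d" using bc cb by auto
  show "b \<otimes> d = c" unfolding bc[symmetric] by (simp add: m_assoc[symmetric] sq)
  show "d \<otimes> c = b" unfolding bc[symmetric] by (simp add: m_assoc sq)
  show "c \<otimes> d = b" unfolding cb[symmetric] by (simp add: m_assoc[symmetric] sq)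
  show "d \<otimes> b = c" unfolding cb[symmetric] by (simp add: m_assoc sq)
qed

lemma absorb [simp]:
  assumes "x \<in> carrier G"
  shows "a \<otimes> (a \<otimes> x) = x" "b \<otimes> (b \<otimes> x) = x" "c \<otimes> (c \<otimes> x) = x" "d \<otimes> (d \<otimes> x) = x"
    "b \<otimes> (c \<otimes> x) = d \<otimes> x" "c \<otimes> (b \<otimes> x) = d \<otimes> x" "b \<otimes> (d \<otimes> x) = c \<otimes> x"
    "d \<otimes> (b \<otimes> x) = c \<otimes> x" "c \<otimes> (d \<otimes> x) = b \<otimes> x" "d \<otimes> (c \<otimes> x) = b \<otimes> x"
  using assms by (simp_all add: m_assoc[symmetric] sq klein_table)

definition klein_reflection :: "('a \<Rightarrow> complex) \<Rightarrow> 'a \<Rightarrow> complex" where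
  "klein_reflection f = (\<lambda>x. 1 / 2 * (translate G b f x + translate G c f x + translate G d f x + (-1) * f x))"

lemma local_klein_reflection: "local_operator G klein_reflection"
  unfolding klein_reflection_def[abs_def]
  by (rule local_scale local_add local_translate local_id closed)+

lemma klein_reflection_apply:
  "x \<in> carrier G \<Longrightarrow> klein_reflection f x = (f (b \<otimes> x) + f (c \<otimes> x) + f (d \<otimes> x) - f x) / 2"
  by (simp add: klein_reflection_def translate_def)

lemma klein_reflection_involution:
  assumes "f \<in> l2_space G" shows "klein_reflection (klein_reflection f) = f"
proof
  fix x
  show "klein_reflection (klein_reflection f) x = f x"
  proof (cases "x \<in> carrier G")
    case True
    then show ?thesis by (simp add: klein_reflection_apply field_simps)
  next
    case False
    then show ?thesis using l2_space_outside[OF assms False] by (simp add: klein_reflection_def translate_def)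
  qed
qed

text \<open>
  Averaging over the four-group: the sum of \<open>|h|\<^sup>2\<close> over the group equals a quarter of the sum of
  its orbit sums, and on each orbit the operator is orthogonal.
\<close>

lemma klein_reflection_isometry:
  assumes f: "f \<in> l2_space G" shows "l2_sq G (klein_reflection f) = l2_sq G f"
proof -
  have Uf: "klein_reflection f \<in> l2_space G"
    using f local_klein_reflection by (simp add: local_operator_def l2_bounded_operatorD(1))
  have avg: "4 * l2_sq G h = (\<Sum>\<^sub>\<infinity>x\<in>carrier G.
      (cmod (h x))\<^sup>2 + (cmod (h (b \<otimes> x)))\<^sup>2 + (cmod (h (c \<otimes> x)))\<^sup>2 + (cmod (h (d \<otimes> x)))\<^sup>2)"
    if h: "h \<in> l2_space G" for h
    using l2_sq_sum4[of h G "translate G b h" "translate G c h" "translate G d h"] h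
    by (simp add: translate_l2) (simp add: translate_def cong: infsum_cong)
  have "4 * l2_sq G (klein_reflection f) = 4 * l2_sq G f"
    unfolding avg[OF Uf] avg[OF f]
  proof (rule infsum_cong)
    fix x assume x: "x \<in> carrier G"
    show "(cmod (klein_reflection f x))\<^sup>2 + (cmod (klein_reflection f (b \<otimes> x)))\<^sup>2 + (cmod (klein_reflection f (c \<otimes> x)))\<^sup>2 + (cmod (klein_reflection f (d \<otimes> x)))\<^sup>2
      = (cmod (f x))\<^sup>2 + (cmod (f (b \<otimes> x)))\<^sup>2 + (cmod (f (c \<otimes> x)))\<^sup>2 + (cmod (f (d \<otimes> x)))\<^sup>2"
      using x klein_orbit_isometry[of "f (b \<otimes> x)" "f (c \<otimes> x)" "f (d \<otimes> x)" "f x"]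
      by (simp add: klein_reflection_apply norm_divide power_divide add_ac)
  qed
  then show ?thesis by simp
qed

lemma markov_eq:
  "markov_operator G {a, b, c, d} f x =
    (if x \<in> carrier G then 1 / 4 * (f (a \<otimes> x) + f (b \<otimes> x) + f (c \<otimes> x) + f (d \<otimes> x)) else 0)"
proof -
  have "distinct [a, b, c, d]" using card4 by (intro card_distinct) simp
  then show ?thesis by (simp add: markov_operator_def card4 add.assoc)
qed

text \<open>
  The Markov operator is \<open>(a + 2U + 1) / 4\<close> for the reflection \<open>U\<close> of the four-group.
\<close>

lemma spectrum_subset: "sp G {a, b, c, d} \<subseteq> complex_of_real ` ({-1/2..0} \<union> {1/2..1})"
  unfolding sp_def
proof (rule two_involutions_spectrum[OF local_translate[OF closed(1)] local_klein_reflection])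
  fix f assume f: "f \<in> l2_space G"
  show "translate G a (translate G a f) = f"
    using f l2_space_outside[OF f] by (auto simp: translate_def)
  show "klein_reflection (klein_reflection f) = f" by (rule klein_reflection_involution[OF f])
  show "l2_sq G (translate G a f) \<le> l2_sq G f" using f by (simp add: translate_l2)
  show "l2_sq G (klein_reflection f) \<le> l2_sq G f" using f by (simp add: klein_reflection_isometry)
next
  have "markov_operator G {a, b, c, d} = (\<lambda>f x. 1 / 4 *
      (translate G a f x + translate G b f x + translate G c f x + translate G d f x))"
    by (auto simp: fun_eq_iff markov_eq translate_def)
  moreover have "l2_bounded_operator G (\<lambda>f x. 1 / 4 *
      (translate G a f x + translate G b f x + translate G c f x + translate G d f x))"
    by (rule bounded_scale bounded_add local_translate[unfolded local_operator_def, THEN conjunct1] closed)+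
  ultimately show "l2_bounded_operator G (markov_operator G {a, b, c, d})" by simp
  show "markov_operator G {a, b, c, d} f x = (translate G a f x + 2 * klein_reflection f x + f x) / 4"
    if f: "f \<in> l2_space G" for f x
    using l2_space_outside[OF f, of x] by (auto simp: markov_eq klein_reflection_def translate_def field_simps)
qed

end

section \<open>The spectrum\<close>

lemma gen_a_involution: "gen_a (gen_a v) = v"
  by (simp add: gen_a_def sigma_involutive)

theorem theorem1p2:
  fixes G :: "('a, 'm) monoid_scheme" and a b c d :: 'a
    and \<omega> :: "nat \<Rightarrow> symbol" and \<phi> :: "'a \<Rightarrow> vertex \<Rightarrow> vertex"
  assumes "group G" and "amenable G"
    and "{a, b, c, d} \<subseteq> carrier G" and "generate G {a, b, c, d} = carrier G"
    and "\<forall>x\<in>{a, b, c, d}. group.ord G x = 2"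
    and "b \<otimes>\<^bsub>G\<^esub> c \<otimes>\<^bsub>G\<^esub> d = \<one>\<^bsub>G\<^esub>"
    and "\<omega> \<in> Omega2"
    and "\<phi> \<in> epi G (G_omega \<omega>)"
    and "\<phi> a = gen_a" and "\<phi> b = gen_b \<omega>" and "\<phi> c = gen_c \<omega>" and "\<phi> d = gen_d \<omega>"
  shows "sp G {a, b, c, d} = complex_of_real ` ({-1/2..0} \<union> {1/2..1})"
proof -
  interpret group G by fact
  note gen_phi = \<open>\<phi> a = gen_a\<close> \<open>\<phi> b = gen_b \<omega>\<close> \<open>\<phi> c = gen_c \<omega>\<close> \<open>\<phi> d = gen_d \<omega>\<close>
  have S: "{a, b, c, d} \<subseteq> carrier G" by fact
  then have carr: "a \<in> carrier G" "b \<in> carrier G" "c \<in> carrier G" "d \<in> carrier G" by auto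
  have invol: "x \<otimes>\<^bsub>G\<^esub> x = \<one>\<^bsub>G\<^esub>" "x \<noteq> \<one>\<^bsub>G\<^esub>" if "x \<in> {a, b, c, d}" for x
  proof -
    have x: "x \<in> carrier G" "ord x = 2" using that S assms(5) by auto
    then show "x \<otimes>\<^bsub>G\<^esub> x = \<one>\<^bsub>G\<^esub>" using pow_ord_eq_1[of x] by (simp add: numeral_2_eq_2)
    show "x \<noteq> \<one>\<^bsub>G\<^esub>" using x ord_id by auto
  qed
  have bcd: "b \<otimes>\<^bsub>G\<^esub> c \<otimes>\<^bsub>G\<^esub> d = \<one>\<^bsub>G\<^esub>" by fact
  \<comment> \<open>The word \<open>0\<close> is moved by \<open>a\<close> and fixed by \<open>b\<close>, \<open>c\<close> and \<open>d\<close>.\<close>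
  have ne: "gen_a \<noteq> gen_b \<omega>" "gen_a \<noteq> gen_c \<omega>" "gen_a \<noteq> gen_d \<omega>"
  proof -
    have "\<not> inner_vertex [False]" by (auto simp: inner_vertex_def)
    then have "sigma_prod (Pi_indices \<omega> r) [False] = [False]" for r
      by (rule sigma_prod_end[OF zero_notin_Pi_indices])
    moreover have "gen_a [False] = [True]" by (simp add: gen_a_Cons)
    ultimately show "gen_a \<noteq> gen_b \<omega>" "gen_a \<noteq> gen_c \<omega>" "gen_a \<noteq> gen_d \<omega>"
      unfolding gen_b_def gen_c_def gen_d_def by (metis list.inject)+
  qed
  have "b \<noteq> c"
  proof
    assume "b = c"
    then have "d = \<one>\<^bsub>G\<^esub>" using bcd invol(1)[of b] carr by simp
    then show False using invol(2)[of d] by simp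
  qed
  moreover have "b \<noteq> d"
  proof
    assume "b = d"
    then have "b \<otimes>\<^bsub>G\<^esub> (c \<otimes>\<^bsub>G\<^esub> b) = b \<otimes>\<^bsub>G\<^esub> b" using bcd invol(1)[of b] carr by (simp add: m_assoc)
    then have "c \<otimes>\<^bsub>G\<^esub> b = b" using carr by (simp only: l_cancel m_closed)
    then have "c = \<one>\<^bsub>G\<^esub>" using carr by (simp only: r_cancel_one)
    then show False using invol(2)[of c] by simp
  qed
  moreover have "c \<noteq> d"
  proof
    assume "c = d"
    then have "b = \<one>\<^bsub>G\<^esub>" using bcd invol(1)[of c] carr by (simp add: m_assoc)
    then show False using invol(2)[of b] by simp
  qed
  ultimately have card4: "card {a, b, c, d} = 4"
    using ne gen_phi by (subst card_insert_disjoint; force)+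
  interpret klein_four_plus_involution G a b c d
    by unfold_locales (use S invol bcd card4 in auto)
  have hom: "\<phi> (g \<otimes>\<^bsub>G\<^esub> h) = \<phi> g \<circ> \<phi> h" if "g \<in> carrier G" "h \<in> carrier G" for g h
  proof -
    have "\<phi> \<in> hom G (G_omega \<omega>)" using assms(8) by (simp add: epi_def)
    from hom_mult[OF this that] show ?thesis by (simp add: G_omega_def AutT_def)
  qed
  have one: "\<phi> \<one>\<^bsub>G\<^esub> = id"
    using hom[OF carr(1) carr(1)] sq(1) by (simp add: gen_phi fun_eq_iff gen_a_involution)
  have len: "length (\<phi> g v) = length v" if "g \<in> carrier G" for g v
    using that[folded assms(4)]
  proof (induction g arbitrary: v rule: generate.induct)
    case (eng g h)
    then show ?case using hom[of g h] assms(4) by simp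
  next
    case (inv h)
    then show ?case by (auto simp: gen_phi)
  qed (auto simp: one gen_phi)
  have bij: "bij_betw (\<phi> g) {v. length v = n} {v. length v = n}" if g: "g \<in> carrier G" for g n
  proof (rule bij_betw_byWitness[where f' = "\<phi> (inv\<^bsub>G\<^esub> g)"])
    have "\<phi> (inv\<^bsub>G\<^esub> g) \<circ> \<phi> g = id" "\<phi> g \<circ> \<phi> (inv\<^bsub>G\<^esub> g) = id"
      using hom[of "inv\<^bsub>G\<^esub> g" g] hom[of g "inv\<^bsub>G\<^esub> g"] g by (simp_all add: one)
    then show "\<forall>v\<in>{v. length v = n}. \<phi> (inv\<^bsub>G\<^esub> g) (\<phi> g v) = v"
      "\<forall>v\<in>{v. length v = n}. \<phi> g (\<phi> (inv\<^bsub>G\<^esub> g) v) = v"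
      by (simp_all add: fun_eq_iff)
  qed (use g in \<open>auto simp: len\<close>)
  have "complex_of_real r \<in> sp G {a, b, c, d}" if r: "r \<in> {-1/2..0} \<union> {1/2..1}" for r
  proof (rule approximate_eigenfunctions_imp_spectrum[where act = \<phi>])
    show "\<phi> (g \<otimes>\<^bsub>G\<^esub> h) v = \<phi> g (\<phi> h v)" if "g \<in> carrier G" "h \<in> carrier G" for g h v
      using hom[OF that] by simp
    fix \<eta> :: real assume "0 < \<eta>"
    obtain n f where nf: "(\<Sum>v | length v = n. (cmod (f v))\<^sup>2) = 2 ^ n"
        "(\<Sum>v | length v = n. (cmod (1 / 4 * (f (gen_a v) + f (gen_b \<omega> v) + f (gen_c \<omega> v) + f (gen_d \<omega> v))
        - of_real r * f v))\<^sup>2) \<le> \<eta> * 2 ^ n"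
      using approximate_eigenfunction_level[OF r \<open>0 < \<eta>\<close>, of \<omega>] by blast
    have "distinct [a, b, c, d]" using card4 by (intro card_distinct) simp
    then have sum: "(\<Sum>s\<in>{a, b, c, d}. f (\<phi> (inv\<^bsub>G\<^esub> s) v))
        = f (gen_a v) + f (gen_b \<omega> v) + f (gen_c \<omega> v) + f (gen_d \<omega> v)" for v
      by (simp add: gen_phi add.assoc)
    have "finite {v :: vertex. length v = n}"
      using finite_lists_length_eq[of "UNIV :: bool set" n] by simp
    then show "\<exists>V f. finite V \<and> (\<forall>g\<in>carrier G. bij_betw (\<phi> g) V V) \<and>
        0 < (\<Sum>x\<in>V. (cmod (f x))\<^sup>2) \<and>
        (\<Sum>x\<in>V. (cmod (1 / of_nat (card {a, b, c, d}) * (\<Sum>s\<in>{a, b, c, d}. f (\<phi> (inv\<^bsub>G\<^esub> s) x))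
          - complex_of_real r * f x))\<^sup>2) \<le> \<eta> * (\<Sum>x\<in>V. (cmod (f x))\<^sup>2)"
      using bij nf by (intro exI[of _ "{v. length v = n}"] exI[of _ f]) (simp add: sum card4)
  qed (use assms(2) S in auto)
  then show ?thesis using spectrum_subset by blast
qed

end
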